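(* Let $p$ be an odd positive integer, let $\Phi=\mathcal S_p^{(\delta t)}$, and let $$\Psi=\Big(I-\big[f_{p+1}(\varepsilon^{(m\delta t)})-m\,f_{p+1}(\varepsilon^{(\delta t)})\big]\mathcal D_{p+1}\Big)^{-1}\mathcal S_p^{(m\delta t)}.$$ Suppose the fine-grid CFL number $\alpha\delta t/h$ is not an integer. Then asymptotically smooth Fourier modes receive a coarse-grid correction that is order $p+2$ small in $\omega$ if they are not characteristic components, while asymptotically smooth characteristic components receive an order one coarse-grid correction in $\omega$: $$\left.\frac{\big|\widetilde A_1(\omega,m\theta)-\widetilde A_1^{\rm ideal}(\omega,m\theta)\big|}{\big|\widetilde A_1(\omega,m\theta)\big|}\right|_{\omega=\mathcal O(h)}=\begin{cases}\mathcal O(\omega^{p+2}), & \theta\not\approx-\dfrac{\omega\alpha\delta t}{h},\\[2ex] \mathcal O(\omega), & \theta\approx-\dfrac{\omega\alpha\delta t}{h}.\end{cases}$$ Precisely: for all $K,\delta>0$ there exist $C,h_0>0$ such that for all $0<h\le h_0$, all $\omega$ with $0<|\omega|\le Kh$, and all $\theta\in[-\pi/m,\pi/m)$, the ratio on the left is at most $C|\omega|^{p+2}$ if $|\theta+\omega\alpha\delta t/h|\ge\delta$, and at most $C|\omega|$ if $|\theta+\omega\alpha\delta t/h|<\delta$.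
   Context: Consider the advection equation $u_t+\alpha u_x=0$, $\alpha>0$, with periodic boundary conditions in space, on an equispaced spatial mesh with $n_x$ points $x_i$ and spacing $h$. Let $m\ge2$ be the MGRIT coarsening factor and $\delta t>0$ the fine time step. The CFL number $c=\alpha\delta t/h$ is held fixed as $h\to0$. For a time step $\tau>0$ put $c_\tau=\alpha\tau/h$ and $\varepsilon^{(\tau)}=c_\tau-\lfloor c_\tau\rfloor\in[0,1)$. The polynomial $f_{p+1}$ is $f_{p+1}(z)=\frac1{(p+1)!}\prod_{q=-\frac{p+1}2}^{\frac{p-1}2}(q+z)$. $\mathcal S_p^{(\tau)}\in\mathbb{R}^{n_x\times n_x}$ is the semi-Lagrangian time-stepping operator of odd order $p$: characteristics are traced back from $x_i$ to $x_i-\alpha\tau$, and the mesh function is evaluated there by degree-$p$ polynomial interpolation on the $p+1$ nearest mesh points. Explicitly, with indices modulo $n_x$, $(\mathcal S_p^{(\tau)}v)_i=\sum_{j=-(p+1)/2}^{(p-1)/2}\ell_j(-\varepsilon^{(\tau)})\,v_{i-\lfloor c_\tau\rfloor+j}$, where $\ell_j$ is the Lagrange basis polynomial with $\ell_j(k)=\delta_{jk}$ on the integer nodes $k\in\{-\frac{p+1}2,\dots,\frac{p-1}2\}$. It is circulant with eigenvalue $s_p^{(\tau)}(\omega)=e^{-\mathrm i\omega\lfloor c_\tau\rfloor}\sum_j\ell_j(-\varepsilon^{(\tau)})e^{\mathrm i\omega j}$ on the spatial Fourier mode $\chi(\omega)=\exp(\mathrm i\omega x/h)$. $\mathcal D_{p+1}\in\mathbb{R}^{n_x\times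 n_x}$ is a circulant matrix (with a fixed finite-difference stencil independent of $h$) such that $h^{-(p+1)}\mathcal D_{p+1}$ is a finite-difference rule of order $s\in\mathbb{N}$, $s\ge1$, for the $(p+1)$st derivative of periodic functions: for smooth enough periodic $v$ (at least $p+1+s$ times continuously differentiable), $(h^{-(p+1)}\mathcal D_{p+1}\mathbf v)_i=v^{(p+1)}(x_i)+\mathcal O(h^s)$, where $\mathbf v=(v(x_1),\dots,v(x_{n_x}))^\top$. The inverse defining $\Psi$ is understood to exist. Let $\lambda(\omega)$ and $\mu(\omega)$ be the eigenvalues of $\Phi$ and $\Psi$ on $\chi(\omega)$. Set $\widetilde A_1(\omega,m\theta)=1-\mu(\omega)e^{-\mathrm i m\theta}$ and $\widetilde A_1^{\rm ideal}(\omega,m\theta)=1-[\lambda(\omega)]^me^{-\mathrm i m\theta}$ (the latter corresponding to $\Psi$ replaced by $\Phi^m$), for $\theta\in\Theta^{\rm low}=[-\pi/m,\pi/m)$. Fourier modes with $\omega=\mathcal O(h)$ are called asymptotically smooth; space-time modes with $\theta\approx-\omega\alpha\delta t/h$ are called characteristic components. Constants in $\mathcal O(\cdot)$ may depend on $p,m,c$ and the stencil of $\mathcal D_{p+1}$, but not on $h,\omega,\theta$. *)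

theory Defs
  imports Complex_Main Jordan_Normal_Form.Char_Poly Jordan_Normal_Form.Gauss_Jordan_Elimination
begin

text \<open>
  The periodic mesh has \<open>n\<close> points \<open>x\<^sub>i = i * h\<close>, \<open>i < n\<close>, so the spatial period is \<open>n * h\<close>.
  Operators on mesh functions are real \<open>n\<close>-by-\<open>n\<close> matrices.
\<close>

definition mesh_point :: "real \<Rightarrow> nat \<Rightarrow> real" where
  "mesh_point h i = real i * h"

definition fourier_mode :: "real \<Rightarrow> nat \<Rightarrow> real \<Rightarrow> complex vec" where
  "fourier_mode h n \<omega> = vec n (\<lambda>i. exp (\<i> * of_real (\<omega> * mesh_point h i / h)))"

text \<open>The frequencies for which the mode is \<open>n\<close>-periodic in the mesh index.\<close>

definition mesh_frequency :: "nat \<Rightarrow> real \<Rightarrow> bool" where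
  "mesh_frequency n \<omega> \<longleftrightarrow> (\<exists>k::int. \<omega> * real n = 2 * pi * of_int k)"

definition cfl :: "real \<Rightarrow> real \<Rightarrow> real \<Rightarrow> real" where
  "cfl \<alpha> h \<tau> = \<alpha> * \<tau> / h"


subsection \<open>Semi-Lagrangian operators\<close>

definition interp_nodes :: "nat \<Rightarrow> int set" where
  "interp_nodes p = {- ((int p + 1) div 2) .. (int p - 1) div 2}"

definition lagrange_basis :: "nat \<Rightarrow> int \<Rightarrow> real \<Rightarrow> real" where
  "lagrange_basis p j z = (\<Prod>k\<in>interp_nodes p - {j}. (z - of_int k) / (of_int j - of_int k))"

text \<open>This is the polynomial \<open>f\<close> with index \<open>p + 1\<close>.\<close>

definition interp_error_poly :: "nat \<Rightarrow> real \<Rightarrow> real" where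
  "interp_error_poly p z = (\<Prod>q\<in>interp_nodes p. of_int q + z) / fact (p + 1)"

text \<open>
  The sum in an entry accounts for several interpolation nodes falling on the same mesh point
  when \<open>n < p + 1\<close>.
\<close>

definition sl_mat :: "nat \<Rightarrow> real \<Rightarrow> real \<Rightarrow> real \<Rightarrow> nat \<Rightarrow> real mat" where
  "sl_mat p \<alpha> h \<tau> n = mat n n (\<lambda>(i, k).
     \<Sum>j | j \<in> interp_nodes p \<and> (int i - \<lfloor>cfl \<alpha> h \<tau>\<rfloor> + j) mod int n = int k.
       lagrange_basis p j (- frac (cfl \<alpha> h \<tau>)))"

definition sl_symbol :: "nat \<Rightarrow> real \<Rightarrow> real \<Rightarrow> real \<Rightarrow> real \<Rightarrow> complex" where
  "sl_symbol p \<alpha> h \<tau> \<omega> =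
     exp (- \<i> * of_real (\<omega> * of_int \<lfloor>cfl \<alpha> h \<tau>\<rfloor>)) *
     (\<Sum>j\<in>interp_nodes p. of_real (lagrange_basis p j (- frac (cfl \<alpha> h \<tau>))) *
        exp (\<i> * of_real (\<omega> * of_int j)))"


subsection \<open>Finite-difference stencils\<close>

text \<open>A stencil is a finitely supported function giving the weight at each mesh offset.\<close>

definition stencil_mat :: "(int \<Rightarrow> real) \<Rightarrow> nat \<Rightarrow> real mat" where
  "stencil_mat d n = mat n n (\<lambda>(i, k). \<Sum>j | d j \<noteq> 0 \<and> (int i + j) mod int n = int k. d j)"

definition stencil_symbol :: "(int \<Rightarrow> real) \<Rightarrow> real \<Rightarrow> complex" where
  "stencil_symbol d \<omega> = (\<Sum>j | d j \<noteq> 0. of_real (d j) * exp (\<i> * of_real (\<omega> * of_int j)))"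

text \<open>
  \<open>h\<close> to the power \<open>- r\<close> times the stencil matrix is a rule of order \<open>s\<close> for the \<open>r\<close>-th
  derivative. Here \<open>V k\<close> is the \<open>k\<close>-th derivative of the test function \<open>V 0\<close>, which is
  \<open>r + s\<close> times continuously differentiable and has period \<open>L\<close>; the meshes on one period
  have spacing \<open>h = L / n\<close>, and \<open>h\<close> tends to \<open>0\<close> as \<open>n\<close> grows.
\<close>

definition finite_difference_rule :: "nat \<Rightarrow> nat \<Rightarrow> (int \<Rightarrow> real) \<Rightarrow> bool" where
  "finite_difference_rule r s d \<longleftrightarrow> finite {j. d j \<noteq> 0} \<and>
     (\<forall>L>0. \<forall>V :: nat \<Rightarrow> real \<Rightarrow> real.
        (\<forall>x. V 0 (x + L) = V 0 x) \<and>
        (\<forall>k<r + s. \<forall>x. (V k has_real_derivative V (Suc k) x) (at x)) \<and>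
        continuous_on UNIV (V (r + s)) \<longrightarrow>
        (\<exists>C. \<forall>\<^sub>F n in sequentially. let h = L / real n in \<forall>i<n.
           \<bar>((1 / h ^ r) \<cdot>\<^sub>v (stencil_mat d n *\<^sub>v vec n (\<lambda>l. V 0 (mesh_point h l)))) $ i
              - V r (mesh_point h i)\<bar> \<le> C * h ^ s))"


subsection \<open>Fine and coarse time-stepping operators\<close>

definition fine_op :: "nat \<Rightarrow> real \<Rightarrow> real \<Rightarrow> real \<Rightarrow> nat \<Rightarrow> real mat" where
  "fine_op p \<alpha> h \<delta>t n = sl_mat p \<alpha> h \<delta>t n"

definition correction_coeff :: "nat \<Rightarrow> nat \<Rightarrow> real \<Rightarrow> real \<Rightarrow> real \<Rightarrow> real" where
  "correction_coeff p m \<alpha> h \<delta>t =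
     interp_error_poly p (frac (cfl \<alpha> h (real m * \<delta>t)))
     - real m * interp_error_poly p (frac (cfl \<alpha> h \<delta>t))"

definition correction_mat ::
  "nat \<Rightarrow> nat \<Rightarrow> (int \<Rightarrow> real) \<Rightarrow> real \<Rightarrow> real \<Rightarrow> real \<Rightarrow> nat \<Rightarrow> real mat" where
  "correction_mat p m d \<alpha> h \<delta>t n = 1\<^sub>m n - correction_coeff p m \<alpha> h \<delta>t \<cdot>\<^sub>m stencil_mat d n"

text \<open>Only meaningful if \<^term>\<open>correction_mat\<close> is invertible.\<close>

definition coarse_op ::
  "nat \<Rightarrow> nat \<Rightarrow> (int \<Rightarrow> real) \<Rightarrow> real \<Rightarrow> real \<Rightarrow> real \<Rightarrow> nat \<Rightarrow> real mat" where
  "coarse_op p m d \<alpha> h \<delta>t n =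
     the (mat_inverse (correction_mat p m d \<alpha> h \<delta>t n)) * sl_mat p \<alpha> h (real m * \<delta>t) n"

text \<open>
  The eigenvalues of the two operators on the Fourier mode of frequency \<open>\<omega>\<close>, as functions of a
  real frequency that do not involve the number of mesh points.
\<close>

definition fine_eigenvalue :: "nat \<Rightarrow> real \<Rightarrow> real \<Rightarrow> real \<Rightarrow> real \<Rightarrow> complex" where
  "fine_eigenvalue p \<alpha> h \<delta>t \<omega> = sl_symbol p \<alpha> h \<delta>t \<omega>"

definition coarse_eigenvalue ::
  "nat \<Rightarrow> nat \<Rightarrow> (int \<Rightarrow> real) \<Rightarrow> real \<Rightarrow> real \<Rightarrow> real \<Rightarrow> real \<Rightarrow> complex" where
  "coarse_eigenvalue p m d \<alpha> h \<delta>t \<omega> =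
     sl_symbol p \<alpha> h (real m * \<delta>t) \<omega> /
     (1 - of_real (correction_coeff p m \<alpha> h \<delta>t) * stencil_symbol d \<omega>)"

definition A1 ::
  "nat \<Rightarrow> nat \<Rightarrow> (int \<Rightarrow> real) \<Rightarrow> real \<Rightarrow> real \<Rightarrow> real \<Rightarrow> real \<Rightarrow> real \<Rightarrow> complex" where
  "A1 p m d \<alpha> h \<delta>t \<omega> \<phi> = 1 - coarse_eigenvalue p m d \<alpha> h \<delta>t \<omega> * exp (- \<i> * of_real \<phi>)"

definition A1_ideal ::
  "nat \<Rightarrow> nat \<Rightarrow> real \<Rightarrow> real \<Rightarrow> real \<Rightarrow> real \<Rightarrow> real \<Rightarrow> complex" where
  "A1_ideal p m \<alpha> h \<delta>t \<omega> \<phi> = 1 - fine_eigenvalue p \<alpha> h \<delta>t \<omega> ^ m * exp (- \<i> * of_real \<phi>)"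

definition cgc_ratio ::
  "nat \<Rightarrow> nat \<Rightarrow> (int \<Rightarrow> real) \<Rightarrow> real \<Rightarrow> real \<Rightarrow> real \<Rightarrow> real \<Rightarrow> real \<Rightarrow> real" where
  "cgc_ratio p m d \<alpha> h \<delta>t \<omega> \<phi> =
     cmod (A1 p m d \<alpha> h \<delta>t \<omega> \<phi> - A1_ideal p m \<alpha> h \<delta>t \<omega> \<phi>) / cmod (A1 p m d \<alpha> h \<delta>t \<omega> \<phi>)"

end

theory Submission
  imports Defs "HOL-Library.Landau_Symbols"
begin

text \<open>
  All matrices involved are circulant, so the Fourier modes diagonalise them, and the eigenvalues
  depend on the mesh and the time step only through the CFL number \<open>c\<close>. The estimate is therefore
  about functions of the single variable \<open>\<omega>\<close> near \<open>0\<close>.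

  Write \<open>X = (\<i> \<omega>)\<^sup>p\<^sup>+\<^sup>1\<close> and let \<open>f\<close> be the polynomial of the interpolation error. Interpolation is exact
  up to degree \<open>p\<close> and has a known error in degree \<open>p + 1\<close>, so a semi-Lagrangian step with CFL
  number \<open>c\<close> has the eigenvalue \<open>exp (- \<i> \<omega> c) (1 - f (frac c) X)\<close> up to a relative error of order
  \<open>p + 2\<close> (\<open>sl_symbol_expansion\<close>). The symbol of a consistent difference rule is \<open>X\<close> up to the same
  order (\<open>stencil_symbol_expansion\<close>). The correction coefficient is chosen so that the inverse replaces
  the error \<open>f (frac (m c))\<close> of the coarse step by the error \<open>m f (frac c)\<close> of \<open>m\<close> fine steps. Hence
  the corrected coarse eigenvalue and the \<open>m\<close>-th power of the fine one differ by order \<open>p + 2\<close>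
  (\<open>fine_eigenvalue_expansion\<close>, \<open>coarse_eigenvalue_expansion\<close>).

  It remains to bound the denominator from below. Off the characteristic it stays away from \<open>0\<close>,
  and the ratio is of order \<open>p + 2\<close>. On the characteristic it can be as small as one minus the modulus
  of the coarse eigenvalue. Since \<open>c\<close> is not an integer, \<open>f (frac c)\<close> is nonzero and has the sign of
  \<open>\<i>\<^sup>p\<^sup>+\<^sup>1\<close> (\<open>interp_error_poly_sign\<close>), so \<open>m f (frac c) X\<close> is a positive multiple of \<open>\<omega>\<^sup>p\<^sup>+\<^sup>1\<close>: the modulus
  is below one by an amount of exact order \<open>p + 1\<close>. The quotient of orders \<open>p + 2\<close> and \<open>p + 1\<close> is the
  remaining order one (\<open>correction_ratio_bounds\<close>).
\<close>

section \<open>Fourier modes as eigenvectors\<close>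

text \<open>
  The entries of a periodic stencil matrix collect all offsets that fall on the same mesh point.
  Grouping the offsets by residue shows that a row of the matrix nevertheless acts offset by offset.
\<close>

lemma sum_over_residues:
  fixes w g :: "int \<Rightarrow> 'a :: comm_semiring_0"
  assumes "finite J" "n > 0"
  shows "(\<Sum>k<n. (\<Sum>j | j \<in> J \<and> (t + j) mod int n = int k. w j) * g (int k))
    = (\<Sum>j\<in>J. w j * g ((t + j) mod int n))"
proof -
  have "(\<Sum>j\<in>J. w j * g ((t + j) mod int n))
      = (\<Sum>k<n. \<Sum>j | j \<in> J \<and> nat ((t + j) mod int n) = k. w j * g ((t + j) mod int n))"
    using assms by (subst sum.group) (auto simp: nat_less_iff)
  also have "\<dots> = (\<Sum>k<n. \<Sum>j | j \<in> J \<and> (t + j) mod int n = int k. w j * g (int k))"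
    using assms by (intro sum.cong) (auto simp: nat_eq_iff2 intro!: Collect_cong)
  finally show ?thesis
    by (simp add: sum_distrib_right)
qed

lemma exp_mode_mod:
  assumes "mesh_frequency n \<omega>"
  shows "exp (\<i> * of_real (\<omega> * of_int (k mod int n))) = exp (\<i> * of_real (\<omega> * of_int k))"
proof -
  obtain l :: int where l: "\<omega> * real n = 2 * pi * of_int l"
    using assms by (auto simp: mesh_frequency_def)
  define q where "q = k div int n"
  have "real_of_int (k mod int n) = of_int k - of_int q * real n"
    unfolding q_def by (metis minus_div_mult_eq_mod of_int_diff of_int_mult of_int_of_nat_eq)
  hence "\<omega> * of_int (k mod int n) = \<omega> * of_int k - of_int q * (\<omega> * real n)"
    by (simp only:) (simp add: algebra_simps)
  hence "\<omega> * of_int (k mod int n) = \<omega> * of_int k - 2 * pi * of_int (q * l)"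
    unfolding l by (simp add: mult_ac)
  hence "cis (\<omega> * of_int (k mod int n)) = cis (\<omega> * of_int k) / cis (2 * pi * of_int (q * l))"
    by (simp only: cis_divide)
  thus ?thesis
    by (simp only: cis_conv_exp [symmetric] cis_multiple_2pi [OF Ints_of_int] div_by_1)
qed

lemma fourier_mode_nth:
  assumes "h > 0" "k < n"
  shows "fourier_mode h n \<omega> $ k = exp (\<i> * of_real (\<omega> * of_int (int k)))"
  using assms by (simp add: fourier_mode_def mesh_point_def)

lemma fourier_mode_carrier: "fourier_mode h n \<omega> \<in> carrier_vec n"
  by (simp add: fourier_mode_def)

lemma fourier_mode_nonzero:
  assumes "h > 0" "n > 0"
  shows "fourier_mode h n \<omega> \<noteq> 0\<^sub>v n"
  using fourier_mode_nth[OF assms, of \<omega>] assms by auto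

text \<open>
  An admissible frequency makes the mode a character of the integers modulo \<open>n\<close>. Moving by an
  offset multiplies it by a constant, so every circulant matrix acts on it by a scalar. The shift
  \<open>t\<close> is separate from the offsets because the semi-Lagrangian stencil is a fixed stencil moved by
  a whole number of cells.
\<close>

lemma circulant_mult_fourier_mode:
  fixes w :: "int \<Rightarrow> real" and t :: int
  assumes A: "A = mat n n (\<lambda>(i, k). \<Sum>j | j \<in> J \<and> (int i + t + j) mod int n = int k. w j)"
    and "finite J" "n > 0" "h > 0" and \<omega>: "mesh_frequency n \<omega>"
  shows "map_mat complex_of_real A *\<^sub>v fourier_mode h n \<omega>
    = (exp (\<i> * of_real (\<omega> * of_int t)) *
       (\<Sum>j\<in>J. of_real (w j) * exp (\<i> * of_real (\<omega> * of_int j)))) \<cdot>\<^sub>v fourier_mode h n \<omega>"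
proof (rule eq_vecI)
  fix i assume "i < dim_vec ((exp (\<i> * of_real (\<omega> * of_int t)) *
       (\<Sum>j\<in>J. of_real (w j) * exp (\<i> * of_real (\<omega> * of_int j)))) \<cdot>\<^sub>v fourier_mode h n \<omega>)"
  hence i: "i < n" by (simp add: fourier_mode_def)
  have "(map_mat complex_of_real A *\<^sub>v fourier_mode h n \<omega>) $ i
      = (\<Sum>k<n. (\<Sum>j | j \<in> J \<and> (int i + t + j) mod int n = int k. complex_of_real (w j)) *
          exp (\<i> * of_real (\<omega> * of_int (int k))))"
    using i assms fourier_mode_carrier[of h n \<omega>]
    by (simp add: A scalar_prod_def atLeast0LessThan fourier_mode_nth del: of_int_of_nat_eq)
  also have "\<dots> = (\<Sum>j\<in>J. of_real (w j) * exp (\<i> * of_real (\<omega> * of_int ((int i + t + j) mod int n))))"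
    by (rule sum_over_residues[OF assms(2,3), where g = "\<lambda>k. exp (\<i> * of_real (\<omega> * of_int k))"])
  also have "\<dots> = (\<Sum>j\<in>J. of_real (w j) * exp (\<i> * of_real (\<omega> * of_int (int i + t + j))))"
    unfolding exp_mode_mod[OF \<omega>] ..
  also have "\<dots> = exp (\<i> * of_real (\<omega> * of_int t)) *
       (\<Sum>j\<in>J. of_real (w j) * exp (\<i> * of_real (\<omega> * of_int j))) * fourier_mode h n \<omega> $ i"
    using i assms
    by (simp add: fourier_mode_nth sum_distrib_left sum_distrib_right ring_distribs exp_add mult_ac)
  finally show "(map_mat complex_of_real A *\<^sub>v fourier_mode h n \<omega>) $ i
     = ((exp (\<i> * of_real (\<omega> * of_int t)) *
       (\<Sum>j\<in>J. of_real (w j) * exp (\<i> * of_real (\<omega> * of_int j)))) \<cdot>\<^sub>v fourier_mode h n \<omega>) $ i"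
    using i fourier_mode_carrier[of h n \<omega>] by simp
qed (simp add: A fourier_mode_def)

lemma sl_mat_mult_fourier_mode:
  assumes "n > 0" "h > 0" "mesh_frequency n \<omega>"
  shows "map_mat complex_of_real (sl_mat p \<alpha> h \<tau> n) *\<^sub>v fourier_mode h n \<omega>
    = sl_symbol p \<alpha> h \<tau> \<omega> \<cdot>\<^sub>v fourier_mode h n \<omega>"
proof -
  have "sl_mat p \<alpha> h \<tau> n = mat n n (\<lambda>(i, k).
      \<Sum>j | j \<in> interp_nodes p \<and> (int i + - \<lfloor>cfl \<alpha> h \<tau>\<rfloor> + j) mod int n = int k.
        lagrange_basis p j (- frac (cfl \<alpha> h \<tau>)))"
    by (simp add: sl_mat_def)
  from circulant_mult_fourier_mode[OF this _ assms] show ?thesis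
    by (simp add: sl_symbol_def interp_nodes_def)
qed

lemma stencil_mat_mult_fourier_mode:
  assumes "finite {j. d j \<noteq> 0}" "n > 0" "h > 0" "mesh_frequency n \<omega>"
  shows "map_mat complex_of_real (stencil_mat d n) *\<^sub>v fourier_mode h n \<omega>
    = stencil_symbol d \<omega> \<cdot>\<^sub>v fourier_mode h n \<omega>"
proof -
  have "stencil_mat d n = mat n n (\<lambda>(i, k).
      \<Sum>j | j \<in> {j. d j \<noteq> 0} \<and> (int i + 0 + j) mod int n = int k. d j)"
    by (simp add: stencil_mat_def)
  from circulant_mult_fourier_mode[OF this assms] show ?thesis
    by (simp add: stencil_symbol_def)
qed

lemma mat_inverse_of_invertible:
  fixes M :: "'a :: field mat"
  assumes M: "M \<in> carrier_mat n n" and inv: "invertible_mat M"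
  shows "the (mat_inverse M) \<in> carrier_mat n n" "the (mat_inverse M) * M = 1\<^sub>m n"
proof -
  obtain B where B: "M * B = 1\<^sub>m (dim_row M)" "B * M = 1\<^sub>m (dim_row B)"
    using inv by (auto simp: invertible_mat_def inverts_mat_def)
  have "dim_col (M * B) = n" "dim_col (B * M) = dim_row B"
    using M B by simp_all
  hence "B \<in> carrier_mat n n"
    using M by auto
  hence "M \<in> Units (ring_mat TYPE('a) n ())"
    using M B by (auto simp: Units_def ring_mat_def intro!: bexI[of _ B])
  then obtain B' where "mat_inverse M = Some B'"
    using mat_inverse(1)[OF M, of "()"] by (cases "mat_inverse M") auto
  with mat_inverse(2)[OF M] show "the (mat_inverse M) \<in> carrier_mat n n"
    "the (mat_inverse M) * M = 1\<^sub>m n"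
    by auto
qed

text \<open>
  The mode is an eigenvector of the matrix being inverted. Its eigenvalue \<open>\<kappa>\<close> cannot vanish when
  that matrix is invertible, so the inverse acts by \<open>1 / \<kappa>\<close>.
\<close>

lemma coarse_op_mult_fourier_mode:
  assumes d: "finite {j. d j \<noteq> 0}" and n: "n > 0" and h: "h > 0" and \<omega>: "mesh_frequency n \<omega>"
    and inv: "invertible_mat (correction_mat p m d \<alpha> h \<delta>t n)"
  shows "map_mat complex_of_real (coarse_op p m d \<alpha> h \<delta>t n) *\<^sub>v fourier_mode h n \<omega>
    = coarse_eigenvalue p m d \<alpha> h \<delta>t \<omega> \<cdot>\<^sub>v fourier_mode h n \<omega>"
proof -
  let ?c = "map_mat complex_of_real" and ?v = "fourier_mode h n \<omega>"
  define M B S D where "M = correction_mat p m d \<alpha> h \<delta>t n" and "B = the (mat_inverse M)"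
    and "S = sl_mat p \<alpha> h (real m * \<delta>t) n" and "D = stencil_mat d n"
  define \<gamma> where "\<gamma> = correction_coeff p m \<alpha> h \<delta>t"
  define \<kappa> where "\<kappa> = 1 - of_real \<gamma> * stencil_symbol d \<omega>"
  have D: "D \<in> carrier_mat n n" and S: "S \<in> carrier_mat n n"
    by (simp_all add: D_def S_def stencil_mat_def sl_mat_def)
  have M_eq: "M = 1\<^sub>m n - \<gamma> \<cdot>\<^sub>m D"
    by (simp add: M_def correction_mat_def \<gamma>_def D_def)
  have M: "M \<in> carrier_mat n n"
    unfolding M_eq using D by (intro minus_carrier_mat smult_carrier_mat)
  have B: "B \<in> carrier_mat n n" "B * M = 1\<^sub>m n"
    using mat_inverse_of_invertible[OF M] inv unfolding B_def M_def by auto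
  have v: "?v \<in> carrier_vec n" by (rule fourier_mode_carrier)
  have "?c M = 1\<^sub>m n - of_real \<gamma> \<cdot>\<^sub>m ?c D"
    using D by (intro eq_matI) (auto simp: M_eq)
  hence "?c M *\<^sub>v ?v = ?v - of_real \<gamma> \<cdot>\<^sub>v (?c D *\<^sub>v ?v)"
    using D v by (simp only:, subst minus_mult_distrib_mat_vec[where nr = n and nc = n])
      (auto intro!: arg_cong[where f = "\<lambda>u. ?v - u"])
  also have "\<dots> = \<kappa> \<cdot>\<^sub>v ?v"
    using v stencil_mat_mult_fourier_mode[OF d n h \<omega>]
    by (intro eq_vecI) (auto simp: D_def \<kappa>_def algebra_simps)
  finally have Mv: "?c M *\<^sub>v ?v = \<kappa> \<cdot>\<^sub>v ?v" .
  have "?v = ?c (B * M) *\<^sub>v ?v"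
    using v B by (simp add: of_real_hom.mat_hom_one)
  also have "\<dots> = ?c B *\<^sub>v (?c M *\<^sub>v ?v)"
    using B(1) M v by (simp add: of_real_hom.mat_hom_mult[where nr = n and n = n and nc = n]
        assoc_mult_mat_vec[where n\<^sub>1 = n and n\<^sub>2 = n and n\<^sub>3 = n])
  finally have Bv: "?v = \<kappa> \<cdot>\<^sub>v (?c B *\<^sub>v ?v)"
    using B v by (simp add: Mv mult_mat_vec[where nr = n and nc = n])
  have \<kappa>: "\<kappa> \<noteq> 0"
  proof
    assume "\<kappa> = 0"
    hence "?v = 0\<^sub>v n" using B by (subst Bv) auto
    thus False using fourier_mode_nonzero[OF h n] by simp
  qed
  have Bv': "?c B *\<^sub>v ?v = inverse \<kappa> \<cdot>\<^sub>v ?v"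
    by (subst (2) Bv) (use \<kappa> in \<open>simp add: smult_smult_assoc\<close>)
  have "?c (coarse_op p m d \<alpha> h \<delta>t n) *\<^sub>v ?v = ?c B *\<^sub>v (?c S *\<^sub>v ?v)"
    using B S v unfolding coarse_op_def M_def[symmetric] B_def[symmetric] S_def[symmetric]
    by (simp add: of_real_hom.mat_hom_mult[where nr = n and n = n and nc = n]
        assoc_mult_mat_vec[where n\<^sub>1 = n and n\<^sub>2 = n and n\<^sub>3 = n])
  also have "?c S *\<^sub>v ?v = sl_symbol p \<alpha> h (real m * \<delta>t) \<omega> \<cdot>\<^sub>v ?v"
    unfolding S_def by (rule sl_mat_mult_fourier_mode[OF n h \<omega>])
  also have "?c B *\<^sub>v (sl_symbol p \<alpha> h (real m * \<delta>t) \<omega> \<cdot>\<^sub>v ?v)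
      = coarse_eigenvalue p m d \<alpha> h \<delta>t \<omega> \<cdot>\<^sub>v ?v"
    using B v by (simp add: mult_mat_vec[where nr = n and nc = n] Bv' smult_smult_assoc coarse_eigenvalue_def
        \<kappa>_def \<gamma>_def field_simps)
  finally show ?thesis .
qed

section \<open>Expansions at frequency zero\<close>

text \<open>
  For a fixed CFL number all symbols are functions of the frequency alone, so a remainder estimate
  that is uniform in the mesh is simply a Landau class at frequency zero.
\<close>

abbreviation vanishing :: "nat \<Rightarrow> (real \<Rightarrow> complex) set" where
  "vanishing n \<equiv> O[at 0](\<lambda>\<omega>. complex_of_real \<omega> ^ n)"

lemma vanishing_mono:
  assumes "f \<in> vanishing n" "m \<le> n"
  shows "f \<in> vanishing m"
proof -
  have "(\<lambda>\<omega>. complex_of_real \<omega> ^ n) \<in> vanishing m"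
  proof (rule bigoI[of _ 1])
    have "\<forall>\<^sub>F \<omega> :: real in at 0. \<bar>\<omega>\<bar> < 1"
      by (auto simp: eventually_at intro!: exI[of _ 1])
    thus "\<forall>\<^sub>F \<omega> in at 0. norm (complex_of_real \<omega> ^ n) \<le> 1 * norm (complex_of_real \<omega> ^ m)"
      by eventually_elim (use assms(2) in \<open>simp add: norm_power power_decreasing\<close>)
  qed
  with assms(1) show ?thesis by (rule landau_o.big_trans)
qed

lemma vanishing_cmult: "f \<in> vanishing n \<Longrightarrow> (\<lambda>\<omega>. c * f \<omega>) \<in> vanishing n"
  by simp

lemma vanishing_mult:
  "f \<in> vanishing m \<Longrightarrow> g \<in> vanishing n \<Longrightarrow> (\<lambda>\<omega>. f \<omega> * g \<omega>) \<in> vanishing (m + n)"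
  by (simp add: landau_o.big.mult power_add)

lemma vanishing_0_of_tendsto: "(f \<longlongrightarrow> l) (at 0) \<Longrightarrow> f \<in> vanishing 0"
  using bigoI_tendsto[of f "\<lambda>_. 1" l "at (0::real)"] by simp

lemma norm_exp_minus_taylor_le:
  fixes z :: "'a :: {real_normed_field, banach}"
  shows "norm (exp z - (\<Sum>k<n. z ^ k / fact k)) \<le> norm z ^ n * exp (norm z)"
proof -
  have sm: "summable (\<lambda>k. z ^ k / fact k)" for z :: "'b :: {real_normed_field, banach}"
    using summable_exp[of z] by (simp add: divide_inverse mult.commute)
  have ex: "exp z = (\<Sum>k. z ^ k / fact k)" for z :: "'b :: {real_normed_field, banach}"
    by (simp add: exp_def scaleR_conv_of_real divide_inverse mult.commute)
  have le: "norm (z ^ (k + n) / fact (k + n)) \<le> norm z ^ n * (norm z ^ k / fact k)" for k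
  proof -
    have "(fact k :: real) \<le> fact (k + n)"
      by (rule fact_mono) simp
    hence "norm z ^ (k + n) / fact (k + n) \<le> norm z ^ (k + n) / fact k"
      by (intro divide_left_mono) auto
    thus ?thesis
      by (simp add: norm_divide norm_mult norm_power power_add mult_ac)
  qed
  have sm': "summable (\<lambda>k. norm z ^ n * (norm z ^ k / fact k))"
    by (intro summable_mult sm)
  have "exp z - (\<Sum>k<n. z ^ k / fact k) = (\<Sum>k. z ^ (k + n) / fact (k + n))"
    unfolding ex by (rule suminf_minus_initial_segment[OF sm, symmetric])
  also have "norm \<dots> \<le> (\<Sum>k. norm z ^ n * (norm z ^ k / fact k))"
    by (rule norm_suminf_le[OF le sm'])
  also have "\<dots> = norm z ^ n * exp (norm z)"
    unfolding ex by (rule suminf_mult[OF sm])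
  finally show ?thesis .
qed

lemma exp_minus_taylor_vanishing:
  "(\<lambda>\<omega>. exp (\<i> * of_real (\<omega> * t)) - (\<Sum>k<n. (\<i> * of_real (\<omega> * t)) ^ k / fact k)) \<in> vanishing n"
proof (rule bigoI)
  have "\<forall>\<^sub>F \<omega> :: real in at 0. \<bar>\<omega>\<bar> < 1"
    by (auto simp: eventually_at intro!: exI[of _ 1])
  thus "\<forall>\<^sub>F \<omega> in at 0. norm (exp (\<i> * of_real (\<omega> * t)) - (\<Sum>k<n. (\<i> * of_real (\<omega> * t)) ^ k / fact k))
      \<le> (\<bar>t\<bar> ^ n * exp \<bar>t\<bar>) * norm (complex_of_real \<omega> ^ n)"
  proof eventually_elim
    case (elim \<omega>)
    have "\<bar>\<omega> * t\<bar> \<le> \<bar>t\<bar>"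
      using elim by (simp add: abs_mult mult_left_le_one_le)
    hence "\<bar>\<omega> * t\<bar> ^ n * exp \<bar>\<omega> * t\<bar> \<le> \<bar>\<omega> * t\<bar> ^ n * exp \<bar>t\<bar>"
      by (intro mult_left_mono) auto
    with norm_exp_minus_taylor_le[of "\<i> * of_real (\<omega> * t)" n] show ?case
      by (simp add: norm_mult norm_power abs_mult power_mult_distrib mult_ac)
  qed
qed

text \<open>
  The Taylor coefficients of the symbol of a stencil are its moments. For interpolation the moments
  are known and give the symbol; for a difference rule consistency determines the moments.
\<close>

lemma exp_sum_minus_moments_vanishing:
  fixes w t :: "'a \<Rightarrow> real"
  shows "(\<lambda>\<omega>. (\<Sum>j\<in>J. of_real (w j) * exp (\<i> * of_real (\<omega> * t j)))
      - (\<Sum>k<n. of_real (\<Sum>j\<in>J. w j * t j ^ k) * (\<i> * of_real \<omega>) ^ k / fact k)) \<in> vanishing n"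
proof -
  define R where "R j \<omega> = exp (\<i> * of_real (\<omega> * t j)) - (\<Sum>k<n. (\<i> * of_real (\<omega> * t j)) ^ k / fact k)" for j \<omega>
  have "of_real (\<Sum>j\<in>J. w j * t j ^ k) * (\<i> * of_real \<omega>) ^ k / fact k
      = (\<Sum>j\<in>J. of_real (w j) * ((\<i> * of_real (\<omega> * t j)) ^ k / fact k))" for k \<omega>
    unfolding of_real_sum sum_distrib_right sum_divide_distrib
    by (intro sum.cong refl) (simp add: power_mult_distrib)
  hence "(\<Sum>k<n. of_real (\<Sum>j\<in>J. w j * t j ^ k) * (\<i> * of_real \<omega>) ^ k / fact k)
      = (\<Sum>j\<in>J. of_real (w j) * (\<Sum>k<n. (\<i> * of_real (\<omega> * t j)) ^ k / fact k))" for \<omega>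
    by (simp only: sum_distrib_left) (rule sum.swap)
  hence "(\<Sum>j\<in>J. of_real (w j) * exp (\<i> * of_real (\<omega> * t j)))
      - (\<Sum>k<n. of_real (\<Sum>j\<in>J. w j * t j ^ k) * (\<i> * of_real \<omega>) ^ k / fact k)
    = (\<Sum>j\<in>J. of_real (w j) * R j \<omega>)" for \<omega>
    by (simp only: R_def right_diff_distrib sum_subtractf)
  moreover have "R j \<in> vanishing n" for j
    unfolding R_def by (rule exp_minus_taylor_vanishing)
  hence "(\<lambda>\<omega>. \<Sum>j\<in>J. of_real (w j) * R j \<omega>) \<in> vanishing n"
    by (intro big_sum_in_bigo) simp
  ultimately show ?thesis
    by presburger
qed

text \<open>
  Asymptotic expansions are unique, even along a single null sequence: the limit kills the constant
  coefficient, and dividing by \<open>x\<close> lowers the order by one.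
\<close>

lemma asymptotic_expansion_coeffs_zero:
  fixes a :: "nat \<Rightarrow> complex" and x :: "nat \<Rightarrow> complex"
  assumes "x \<longlonglongrightarrow> 0" "\<forall>\<^sub>F N in sequentially. x N \<noteq> 0"
    and "(\<lambda>N. \<Sum>k<n. a k * x N ^ k) \<in> O(\<lambda>N. x N ^ n)"
  shows "\<forall>k<n. a k = 0"
  using assms(3)
proof (induction n arbitrary: a)
  case (Suc n)
  let ?G = "\<lambda>N. \<Sum>k<Suc n. a k * x N ^ k"
  have G: "?G = (\<lambda>N. a 0 + x N * (\<Sum>k<n. a (Suc k) * x N ^ k))"
    unfolding sum.lessThan_Suc_shift sum_distrib_left by (simp add: mult.left_commute)
  have "?G \<longlonglongrightarrow> a 0 + 0 * (\<Sum>k<n. a (Suc k) * 0 ^ k)"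
    unfolding G by (intro tendsto_intros assms(1))
  moreover have "?G \<longlonglongrightarrow> 0"
  proof -
    obtain C where C: "\<forall>\<^sub>F N in sequentially. norm (?G N) \<le> C * norm (x N ^ Suc n)"
      using Suc.prems by (auto elim: landau_o.bigE)
    have "(\<lambda>N. x N ^ Suc n) \<longlonglongrightarrow> 0 ^ Suc n"
      by (intro tendsto_intros assms(1))
    hence "(\<lambda>N. x N ^ Suc n) \<longlonglongrightarrow> 0"
      by simp
    thus ?thesis
      by (rule tendsto_0_le[where K = C]) (use C in \<open>simp only: mult.commute\<close>)
  qed
  ultimately have "a 0 + 0 * (\<Sum>k<n. a (Suc k) * 0 ^ k) = 0"
    by (rule LIMSEQ_unique)
  hence a0: "a 0 = 0"
    by simp
  have "(\<lambda>N. x N * (\<Sum>k<n. a (Suc k) * x N ^ k)) \<in> O(\<lambda>N. x N * x N ^ n)"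
    using Suc.prems unfolding G a0 by (simp only: add_0_left power_Suc)
  hence "(\<lambda>N. \<Sum>k<n. a (Suc k) * x N ^ k) \<in> O(\<lambda>N. x N ^ n)"
    by (rule landau_o.big.mult_cancel_left[OF bigtheta_refl assms(2), THEN iffD1])
  from Suc.IH[OF this] a0 show ?case
    by (auto simp: less_Suc_eq_0_disj)
qed simp

lemma vanishingE:
  assumes "f \<in> vanishing n"
  obtains C \<rho> where "0 < C" "0 < \<rho>" "\<And>\<omega>. 0 < \<bar>\<omega>\<bar> \<Longrightarrow> \<bar>\<omega>\<bar> < \<rho> \<Longrightarrow> cmod (f \<omega>) \<le> C * \<bar>\<omega>\<bar> ^ n"
proof -
  from assms obtain C where C: "C > 0" "\<forall>\<^sub>F \<omega> in at 0. cmod (f \<omega>) \<le> C * cmod (complex_of_real \<omega> ^ n)"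
    by (rule landau_o.bigE)
  from C(2) obtain \<rho> where "\<rho> > 0" "\<And>\<omega>. \<omega> \<noteq> 0 \<Longrightarrow> dist \<omega> 0 < \<rho> \<Longrightarrow> cmod (f \<omega>) \<le> C * cmod (complex_of_real \<omega> ^ n)"
    unfolding eventually_at by auto
  with C(1) show ?thesis
    by (intro that[of C \<rho>]) (auto simp: norm_power)
qed

lemma ii_omega_power_vanishing: "(\<lambda>\<omega>. (\<i> * complex_of_real \<omega>) ^ k) \<in> vanishing k"
  by (rule bigoI[of _ 1]) (simp add: norm_mult norm_power)

section \<open>Polynomial interpolation\<close>

text \<open>
  Interpolation at \<open>N\<close> nodes reproduces polynomials of degree below \<open>N\<close>. In degree \<open>N\<close> subtracting
  the multiple of the node polynomial that removes the leading term does not change the values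
  at the nodes; this gives the interpolation error exactly.
\<close>

lemma lagrange_interpolation_degree_le:
  fixes x :: "'i \<Rightarrow> real" and g :: "real poly"
  assumes J: "finite J" "J \<noteq> {}" "inj_on x J" and g: "degree g \<le> card J"
  shows "(\<Sum>j\<in>J. (\<Prod>k\<in>J - {j}. (z - x k) / (x j - x k)) * poly g (x j))
    = poly g z - Polynomial.coeff g (card J) * (\<Prod>j\<in>J. z - x j)"
proof -
  define N where "N = (\<Prod>j\<in>J. [:- x j, 1:])"
  define L where "L = (\<lambda>j. Polynomial.smult (1 / (\<Prod>k\<in>J - {j}. x j - x k)) (\<Prod>k\<in>J - {j}. [:- x k, 1:]))"
  define P where "P = (\<Sum>j\<in>J. Polynomial.smult (poly g (x j)) (L j))"
  define Q where "Q = g - Polynomial.smult (Polynomial.coeff g (card J)) N"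
  have polyL: "poly (L j) y = (\<Prod>k\<in>J - {j}. (y - x k) / (x j - x k))" for j y
    by (simp add: L_def poly_prod prod_dividef)
  have polyN: "poly N y = (\<Prod>j\<in>J. y - x j)" for y
    by (simp add: N_def poly_prod)
  have degN: "degree N = card J"
    unfolding N_def by (subst degree_prod_sum_eq) auto
  have "lead_coeff N = 1"
    unfolding N_def by (simp add: lead_coeff_prod)
  hence "Polynomial.coeff Q (card J) = 0"
    by (simp add: Q_def degN)
  moreover have "degree Q \<le> card J"
    unfolding Q_def using g degN by (intro degree_diff_le) (auto intro: order_trans[OF degree_smult_le])
  ultimately have degQ: "degree Q < card J"
    using J by (metis card_gt_0_iff degree_0 leading_coeff_0_iff le_neq_implies_less)
  have "degree (L j) < card J" if "j \<in> J" for j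
  proof -
    have "degree (\<Prod>k\<in>J - {j}. [:- x k, 1:]) = card (J - {j})"
      by (subst degree_prod_sum_eq) auto
    thus ?thesis
      unfolding L_def using that J by (simp add: card_Diff_singleton card_gt_0_iff)
  qed
  hence "degree P \<le> card J - 1"
    unfolding P_def by (intro degree_sum_le J) (force intro: order_trans[OF degree_smult_le])
  hence degP: "degree P < card J"
    using J by (simp add: card_gt_0_iff Suc_le_eq le_diff_conv flip: less_Suc_eq_le)
  have "P = Q"
  proof (rule poly_eqI_degree)
    show "card (x ` J) > degree P" "card (x ` J) > degree Q"
      using degP degQ J by (simp_all add: card_image)
  next
    fix y assume "y \<in> x ` J"
    then obtain i where i: "i \<in> J" "y = x i" by auto
    have L: "poly (L j) y = (if j = i then 1 else 0)" if "j \<in> J" for j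
    proof (cases "j = i")
      case True
      have "(\<Prod>k\<in>J - {i}. (x i - x k) / (x i - x k)) = 1"
        using i J by (intro prod.neutral) (auto simp: inj_on_def)
      with True show ?thesis by (simp add: polyL i)
    next
      case False
      with i J show ?thesis by (auto simp: polyL intro!: prod_zero)
    qed
    have "poly P y = (\<Sum>j\<in>J. poly g (x j) * (if j = i then 1 else 0))"
      by (simp add: P_def poly_sum L cong: sum.cong)
    also have "\<dots> = poly g y"
      using i J by (simp add: sum.delta if_distrib cong: if_cong)
    also have "\<dots> = poly Q y"
      using i J by (auto simp: Q_def polyN intro!: prod_zero)
    finally show "poly P y = poly Q y" .
  qed
  hence "poly P z = poly Q z" by simp
  thus ?thesis
    by (simp add: P_def Q_def polyN polyL poly_sum mult_ac)
qed

lemma finite_interp_nodes [simp]: "finite (interp_nodes p)"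
  by (simp add: interp_nodes_def)

lemma interp_nodes_odd:
  assumes "odd p"
  shows "interp_nodes p = {- int ((p + 1) div 2) ..< int ((p + 1) div 2)}"
  using assms by (auto simp: interp_nodes_def elim!: oddE)

lemma card_interp_nodes:
  assumes "odd p"
  shows "card (interp_nodes p) = p + 1"
  using assms by (auto simp: interp_nodes_odd elim!: oddE)

text \<open>
  The interpolation error of the monomial of degree \<open>p + 1\<close> at \<open>- e\<close> is the node polynomial. The
  number of nodes is even, so changing the sign of every factor turns it into the polynomial of the
  coarse-grid correction.
\<close>

lemma lagrange_moments:
  assumes p: "odd p" and k: "k \<le> p + 1"
  shows "(\<Sum>j\<in>interp_nodes p. lagrange_basis p j (- e) * of_int j ^ k)
    = (- e) ^ k - (if k = p + 1 then fact (p + 1) * interp_error_poly p e else 0)"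
proof -
  let ?J = "interp_nodes p"
  have "?J \<noteq> {}"
    using card_interp_nodes[OF p] by auto
  hence "(\<Sum>j\<in>?J. (\<Prod>i\<in>?J - {j}. (- e - of_int i) / (of_int j - of_int i)) * poly (monom 1 k) (of_int j))
      = poly (monom 1 k) (- e) - Polynomial.coeff (monom 1 k) (card ?J) * (\<Prod>j\<in>?J. - e - of_int j)"
    using k by (intro lagrange_interpolation_degree_le)
      (auto simp: inj_on_def card_interp_nodes[OF p] degree_monom_eq)
  moreover have "(\<Prod>j\<in>?J. - e - of_int j) = (\<Prod>j\<in>?J. of_int j + e)"
  proof -
    have "(\<Prod>j\<in>?J. - e - of_int j) = (\<Prod>j\<in>?J. (- 1) * (of_int j + e))"
      by (intro prod.cong) auto
    also have "\<dots> = (\<Prod>j\<in>?J. of_int j + e)"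
      using p by (simp only: prod.distrib prod_constant card_interp_nodes[OF p]) simp
    finally show ?thesis .
  qed
  ultimately show ?thesis
    by (simp add: lagrange_basis_def interp_error_poly_def poly_monom card_interp_nodes[OF p])
qed

text \<open>
  Exactly half of the nodes are negative, and for \<open>e\<close> strictly between \<open>0\<close> and \<open>1\<close> no factor
  vanishes. This is where a non-integer CFL number is used: it makes the scheme dissipative at
  leading order.
\<close>

lemma interp_error_poly_sign:
  assumes p: "odd p" and e: "0 < e" "e < 1"
  shows "0 < (- 1) ^ ((p + 1) div 2) * interp_error_poly p e"
proof -
  have "0 < (- 1) ^ a * (\<Prod>q\<in>{- int a ..< int a}. of_int q + e)" for a
  proof (induction a)
    case (Suc a)
    have *: "{- int (Suc a) ..< int (Suc a)} = insert (int a) (insert (- int a - 1) {- int a ..< int a})"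
      by auto
    have "(- 1) ^ Suc a * (\<Prod>q\<in>{- int (Suc a) ..< int (Suc a)}. of_int q + e)
        = ((real a + e) * (real a + 1 - e)) * ((- 1) ^ a * (\<Prod>q\<in>{- int a ..< int a}. of_int q + e))"
      unfolding * by (simp add: algebra_simps)
    also have "\<dots> > 0"
      using e by (intro mult_pos_pos Suc.IH) auto
    finally show ?case .
  qed simp
  from this[of "(p + 1) div 2"] show ?thesis
    by (simp add: interp_error_poly_def interp_nodes_odd[OF p])
qed

section \<open>Expansion of the eigenvalues\<close>

text \<open>
  Interpolating the mode at the foot of the characteristic gives the exact factor
  \<open>exp (- \<i> \<omega> c)\<close> up to the interpolation error. That error begins with the moment of order \<open>p + 1\<close>.
  Multiplying by \<open>exp (\<i> \<omega> c)\<close> removes the exact translation and leaves the relative error.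
\<close>

lemma sl_symbol_expansion:
  assumes p: "odd p" and c: "cfl \<alpha> h \<tau> = c"
  shows "(\<lambda>\<omega>. exp (\<i> * of_real (\<omega> * c)) * sl_symbol p \<alpha> h \<tau> \<omega>
      - (1 - of_real (interp_error_poly p (frac c)) * (\<i> * of_real \<omega>) ^ (p + 1))) \<in> vanishing (p + 2)"
proof -
  let ?J = "interp_nodes p"
  define e where "e = frac c"
  define f where "f = complex_of_real (interp_error_poly p e)"
  define I where "I \<omega> = (\<Sum>j\<in>?J. of_real (lagrange_basis p j (- e)) * exp (\<i> * of_real (\<omega> * of_int j)))" for \<omega>
  define X where "X \<omega> = (\<i> * complex_of_real \<omega>) ^ (p + 1)" for \<omega>
  have T: "(\<Sum>k<p + 2. of_real (\<Sum>j\<in>?J. lagrange_basis p j (- e) * of_int j ^ k) * (\<i> * of_real \<omega>) ^ k / fact k)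
      = (\<Sum>k<p + 2. (\<i> * of_real (\<omega> * - e)) ^ k / fact k) - f * X \<omega>" (is "?L = ?R") for \<omega>
  proof -
    have "?L = (\<Sum>k<p + 2. (\<i> * of_real (\<omega> * - e)) ^ k / fact k - (if k = p + 1 then f * X \<omega> else 0))"
    proof (rule sum.cong[OF refl])
      fix k assume "k \<in> {..<p + 2}"
      hence k: "k \<le> p + 1" by simp
      have "(\<i> * complex_of_real (\<omega> * - e)) ^ k = of_real (- e) ^ k * (\<i> * of_real \<omega>) ^ k"
        unfolding power_mult_distrib[symmetric] by (simp add: mult_ac)
      moreover have "complex_of_real (fact (p + 1) * interp_error_poly p e) = fact (p + 1) * f"
        by (simp only: of_real_mult of_real_fact f_def)
      ultimately show "of_real (\<Sum>j\<in>?J. lagrange_basis p j (- e) * of_int j ^ k) * (\<i> * of_real \<omega>) ^ k / fact k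
          = (\<i> * of_real (\<omega> * - e)) ^ k / fact k - (if k = p + 1 then f * X \<omega> else 0)"
        unfolding lagrange_moments[OF p k]
        by (auto simp: X_def diff_divide_distrib left_diff_distrib simp del: fact_Suc)
    qed
    thus ?thesis
      by (simp only: sum_subtractf) simp
  qed
  have "(\<lambda>\<omega>. I \<omega> - ((\<Sum>k<p + 2. (\<i> * of_real (\<omega> * - e)) ^ k / fact k) - f * X \<omega>)) \<in> vanishing (p + 2)"
    unfolding T[symmetric] I_def by (rule exp_sum_minus_moments_vanishing)
  from sum_in_bigo(2)[OF this exp_minus_taylor_vanishing[of "- e" "p + 2"]]
  have "(\<lambda>\<omega>. I \<omega> - exp (\<i> * of_real (\<omega> * - e)) + f * X \<omega>) \<in> vanishing (p + 2)"
    by (simp add: algebra_simps)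
  moreover have "(\<lambda>\<omega>. exp (\<i> * of_real (\<omega> * e))) \<in> vanishing 0"
    by (rule vanishing_0_of_tendsto) (rule tendsto_intros | rule tendsto_ident_at)+
  ultimately have 1: "(\<lambda>\<omega>. exp (\<i> * of_real (\<omega> * e)) * (I \<omega> - exp (\<i> * of_real (\<omega> * - e)) + f * X \<omega>)) \<in> vanishing (p + 2)"
    using vanishing_mult[of _ 0 _ "p + 2"] by simp
  have "(\<lambda>\<omega>. X \<omega> * (exp (\<i> * of_real (\<omega> * e)) - 1)) \<in> vanishing (p + 1 + 1)"
  proof (rule vanishing_mult)
    show "X \<in> vanishing (p + 1)"
      by (rule bigoI[of _ 1]) (simp add: X_def norm_mult norm_power)
    show "(\<lambda>\<omega>. exp (\<i> * of_real (\<omega> * e)) - 1) \<in> vanishing 1"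
      using exp_minus_taylor_vanishing[of e 1] by simp
  qed
  hence "(\<lambda>\<omega>. f * (X \<omega> * (exp (\<i> * of_real (\<omega> * e)) - 1))) \<in> vanishing (p + 2)"
    by simp
  from sum_in_bigo(2)[OF 1 this]
  have "(\<lambda>\<omega>. exp (\<i> * of_real (\<omega> * e)) * I \<omega> - (1 - f * X \<omega>)) \<in> vanishing (p + 2)"
    by (rule landau_o.big.in_cong[THEN iffD1, rotated])
      (auto intro!: always_eventually simp: algebra_simps simp flip: exp_add)
  moreover have "exp (\<i> * of_real (\<omega> * c)) * sl_symbol p \<alpha> h \<tau> \<omega> = exp (\<i> * of_real (\<omega> * e)) * I \<omega>" for \<omega>
  proof -
    have "c = of_int \<lfloor>c\<rfloor> + e" by (simp add: e_def frac_def)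
    hence "\<i> * of_real (\<omega> * c) + - \<i> * of_real (\<omega> * of_int \<lfloor>c\<rfloor>) = \<i> * of_real (\<omega> * e)"
      by (metis (no_types, opaque_lifting) add_diff_cancel_left' diff_conv_add_uminus mult_minus_left of_real_diff right_diff_distrib)
    hence "exp (\<i> * of_real (\<omega> * c)) * exp (- \<i> * of_real (\<omega> * of_int \<lfloor>c\<rfloor>)) = exp (\<i> * of_real (\<omega> * e))"
      by (metis exp_add)
    thus ?thesis
      by (simp only: sl_symbol_def c I_def e_def[symmetric] mult.assoc[symmetric])
  qed
  ultimately show ?thesis
    by (simp add: X_def f_def e_def)
qed

lemma stencil_mult_vec_0:
  fixes g :: "real \<Rightarrow> real"
  assumes d: "finite {j. d j \<noteq> 0}" and n: "n > 0" and per: "\<And>k::int. g (of_int (k mod int n) * h) = g (of_int k * h)"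
  shows "(stencil_mat d n *\<^sub>v Matrix.vec n (\<lambda>l. g (mesh_point h l))) $ 0
    = (\<Sum>j | d j \<noteq> 0. d j * g (of_int j * h))"
proof -
  have "(stencil_mat d n *\<^sub>v Matrix.vec n (\<lambda>l. g (mesh_point h l))) $ 0
      = (\<Sum>k<n. (\<Sum>j | j \<in> {j. d j \<noteq> 0} \<and> (0 + j) mod int n = int k. d j) * g (of_int (int k) * h))"
    using n by (simp add: stencil_mat_def scalar_prod_def atLeast0LessThan mesh_point_def)
  also have "\<dots> = (\<Sum>j | d j \<noteq> 0. d j * g (of_int ((0 + j) mod int n) * h))"
    by (rule sum_over_residues[OF d n, where g = "\<lambda>k. g (of_int k * h)"])
  finally show ?thesis
    by (simp add: per)
qed

lemma cos_has_shifted_derivative: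
  "((\<lambda>x. cos (x + b + real k * pi / 2)) has_real_derivative cos (x + b + real (Suc k) * pi / 2)) (at x)"
proof -
  have "cos (x + b + real (Suc k) * pi / 2) = cos ((x + b + real k * pi / 2) + pi / 2)"
    by (simp add: algebra_simps add_divide_distrib)
  also have "\<dots> = - sin (x + b + real k * pi / 2)"
    by (simp add: cos_add)
  finally show ?thesis
    by (auto intro!: derivative_eq_intros)
qed

text \<open>
  Among smooth test functions a translated cosine suffices, since its derivatives are translates of
  itself. Periodicity makes the wrap-around of the stencil invisible, and row \<open>0\<close> carries all the
  information. The phase \<open>b\<close> provides both the cosine and the sine.
\<close>

lemma fd_rule_cos:
  assumes fd: "finite_difference_rule r s d"
  shows "\<exists>C. \<forall>\<^sub>F n in sequentially.
    \<bar>(\<Sum>j | d j \<noteq> 0. d j * cos (of_int j * (2 * pi / real n) + b)) - (2 * pi / real n) ^ r * cos (b + real r * pi / 2)\<bar>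
      \<le> C * (2 * pi / real n) ^ (r + s)"
proof -
  define V where "V k x = cos (x + b + real k * pi / 2)" for k :: nat and x :: real
  have fin: "finite {j. d j \<noteq> 0}"
    using fd by (simp add: finite_difference_rule_def)
  have "\<forall>x. V 0 (x + 2 * pi) = V 0 x"
  proof
    fix x
    have "x + 2 * pi + b = (x + b) + 2 * pi" by simp
    thus "V 0 (x + 2 * pi) = V 0 x" unfolding V_def by (simp only:) simp
  qed
  moreover have "\<forall>k<r + s. \<forall>x. (V k has_real_derivative V (Suc k) x) (at x)"
    using cos_has_shifted_derivative[of b] by (simp add: V_def[abs_def])
  moreover have "continuous_on UNIV (V (r + s))"
    unfolding V_def by (intro continuous_intros)
  ultimately have "\<exists>C. \<forall>\<^sub>F n in sequentially. let h = 2 * pi / real n in \<forall>i<n.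
           \<bar>((1 / h ^ r) \<cdot>\<^sub>v (stencil_mat d n *\<^sub>v Matrix.vec n (\<lambda>l. V 0 (mesh_point h l)))) $ i
              - V r (mesh_point h i)\<bar> \<le> C * h ^ s"
    by (intro fd[unfolded finite_difference_rule_def, THEN conjunct2, THEN spec[of _ "2 * pi"],
          THEN mp, THEN spec[of _ V], THEN mp] conjI) simp_all
  then obtain C where C: "\<forall>\<^sub>F n in sequentially. let h = 2 * pi / real n in \<forall>i<n.
           \<bar>((1 / h ^ r) \<cdot>\<^sub>v (stencil_mat d n *\<^sub>v Matrix.vec n (\<lambda>l. V 0 (mesh_point h l)))) $ i
              - V r (mesh_point h i)\<bar> \<le> C * h ^ s" ..
  have "\<forall>\<^sub>F n in sequentially.
    \<bar>(\<Sum>j | d j \<noteq> 0. d j * cos (of_int j * (2 * pi / real n) + b)) - (2 * pi / real n) ^ r * cos (b + real r * pi / 2)\<bar>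
      \<le> C * (2 * pi / real n) ^ (r + s)"
    using C eventually_gt_at_top[of 0]
  proof eventually_elim
    case (elim n)
    define h where "h = 2 * pi / real n"
    have h: "h > 0" using elim by (simp add: h_def)
    have per: "V 0 (of_int (k mod int n) * h) = V 0 (of_int k * h)" for k
    proof -
      have "real_of_int k = of_int (k mod int n) + of_int (k div int n) * real n"
        by (metis mod_div_mult_eq of_int_add of_int_mult of_int_of_nat_eq)
      hence "of_int k * h = of_int (k mod int n) * h + of_int (k div int n) * (real n * h)"
        by (simp only: distrib_right mult.assoc)
      hence "of_int k * h + b = (of_int (k mod int n) * h + b) + 2 * pi * of_int (k div int n)"
        using elim by (simp add: h_def)
      moreover have "cos (y + 2 * pi * of_int q) = cos y" for y :: real and q :: int
        by (simp add: cos_add)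
      ultimately show ?thesis
        by (simp only: V_def add.right_neutral of_nat_0 mult_zero_left div_0)
    qed
    define S where "S = (\<Sum>j | d j \<noteq> 0. d j * V 0 (of_int j * h))"
    have "\<bar>(1 / h ^ r) * S - V r 0\<bar> \<le> C * h ^ s"
      using elim stencil_mult_vec_0[OF fin, of n "V 0" h] per
      by (auto simp: Let_def S_def mesh_point_def stencil_mat_def simp flip: h_def)
    hence "h ^ r * \<bar>(1 / h ^ r) * S - V r 0\<bar> \<le> h ^ r * (C * h ^ s)"
      using h by (intro mult_left_mono) auto
    moreover have "h ^ r * \<bar>(1 / h ^ r) * S - V r 0\<bar> = \<bar>h ^ r * ((1 / h ^ r) * S - V r 0)\<bar>"
      using h by (simp add: abs_mult)
    moreover have "h ^ r * ((1 / h ^ r) * S - V r 0) = S - h ^ r * V r 0"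
      using h by (simp add: right_diff_distrib)
    ultimately have "\<bar>S - h ^ r * V r 0\<bar> \<le> C * h ^ (r + s)"
      by (simp add: power_add mult_ac)
    thus ?case
      by (simp add: S_def V_def h_def)
  qed
  thus ?thesis by blast
qed

text \<open>
  Consistency of the rule on the mode of wavelength \<open>2 \<pi>\<close> controls the symbol at the frequencies
  \<open>2 \<pi> / n\<close> only. They accumulate at zero, so uniqueness of expansions determines the moments up to
  order \<open>r\<close>, and the moments determine the symbol near zero.
\<close>

lemma stencil_symbol_expansion:
  assumes fd: "finite_difference_rule r s d" and s: "1 \<le> s"
  shows "(\<lambda>\<omega>. stencil_symbol d \<omega> - (\<i> * of_real \<omega>) ^ r) \<in> vanishing (r + 1)"
proof -
  define h where "h n = 2 * pi / real n" for n
  have h0: "h \<longlonglongrightarrow> 0"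
    unfolding h_def by (rule real_tendsto_divide_at_top[OF tendsto_const filterlim_real_sequentially])
  have hpos: "\<forall>\<^sub>F n in sequentially. h n > 0"
    using eventually_gt_at_top[of 0] by eventually_elim (simp add: h_def)
  have hat: "filterlim h (at 0) sequentially"
    using h0 hpos by (auto simp: filterlim_at elim: eventually_mono)
  define M where "M k = (\<Sum>j | d j \<noteq> 0. d j * of_int j ^ k)" for k
  have E: "(\<lambda>\<omega>. stencil_symbol d \<omega> - (\<Sum>k<r + 1. of_real (M k) * (\<i> * of_real \<omega>) ^ k / fact k)) \<in> vanishing (r + 1)"
    unfolding stencil_symbol_def M_def by (rule exp_sum_minus_moments_vanishing)
  have "(\<lambda>n. stencil_symbol d (h n) - (\<i> * of_real (h n)) ^ r) \<in> O(\<lambda>n. of_real (h n) ^ (r + 1))"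
  proof -
    obtain C1 where C1: "\<forall>\<^sub>F n in sequentially. \<bar>(\<Sum>j | d j \<noteq> 0. d j * cos (of_int j * h n + 0)) - h n ^ r * cos (0 + real r * pi / 2)\<bar>
        \<le> C1 * h n ^ (r + s)"
      using fd_rule_cos[OF fd, of 0] unfolding h_def by auto
    obtain C2 where C2: "\<forall>\<^sub>F n in sequentially. \<bar>(\<Sum>j | d j \<noteq> 0. d j * cos (of_int j * h n + - (pi / 2))) - h n ^ r * cos (- (pi / 2) + real r * pi / 2)\<bar>
        \<le> C2 * h n ^ (r + s)"
      using fd_rule_cos[OF fd, of "- (pi / 2)"] unfolding h_def by auto
    have small: "\<forall>\<^sub>F n in sequentially. h n < 1"
      using h0 by (rule order_tendstoD(2)) simp
    have "\<forall>\<^sub>F n in sequentially. norm (stencil_symbol d (h n) - (\<i> * of_real (h n)) ^ r)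
        \<le> (\<bar>C1\<bar> + \<bar>C2\<bar>) * norm (complex_of_real (h n) ^ (r + 1))"
      using C1 C2 hpos small
    proof eventually_elim
      case (elim n)
      define z where "z = stencil_symbol d (h n) - (\<i> * of_real (h n)) ^ r"
      have cis_r: "\<i> ^ r = cis (real r * (pi / 2))"
        by (simp add: DeMoivre flip: cis_pi_half)
      have sin_eq: "sin y = cos (y + - (pi / 2))" for y :: real
        by (simp add: cos_diff)
      have Re: "Re z = (\<Sum>j | d j \<noteq> 0. d j * cos (of_int j * h n)) - h n ^ r * cos (real r * pi / 2)"
        by (simp add: z_def stencil_symbol_def power_mult_distrib cis_r mult_ac flip: cis_conv_exp of_real_power of_real_mult)
      have Im: "Im z = (\<Sum>j | d j \<noteq> 0. d j * sin (of_int j * h n)) - h n ^ r * sin (real r * pi / 2)"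
        by (simp add: z_def stencil_symbol_def power_mult_distrib cis_r mult_ac flip: cis_conv_exp of_real_power of_real_mult)
      have "h n ^ (r + s) \<le> h n ^ (r + 1)"
        using elim s by (intro power_decreasing) auto
      hence le: "C * h n ^ (r + s) \<le> \<bar>C\<bar> * h n ^ (r + 1)" for C
        using elim by (intro mult_mono) auto
      have "\<bar>Re z\<bar> \<le> \<bar>C1\<bar> * h n ^ (r + 1)"
        using elim(1) unfolding Re by (intro order_trans[OF _ le]) simp
      moreover have "\<bar>Im z\<bar> \<le> \<bar>C2\<bar> * h n ^ (r + 1)"
        using elim(2) unfolding Im sin_eq by (intro order_trans[OF _ le]) (simp add: algebra_simps)
      ultimately have "cmod z \<le> (\<bar>C1\<bar> + \<bar>C2\<bar>) * h n ^ (r + 1)"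
        using cmod_le[of z] unfolding distrib_right by linarith
      moreover have "norm (complex_of_real (h n) ^ (r + 1)) = h n ^ (r + 1)"
        using elim(3) by (simp add: norm_mult norm_power)
      ultimately show ?case
        by (simp only: z_def)
    qed
    thus ?thesis by (rule bigoI)
  qed
  from sum_in_bigo(2)[OF this landau_o.big.compose[OF E hat]]
  have diff: "(\<lambda>n. (\<Sum>k<r + 1. of_real (M k) * (\<i> * of_real (h n)) ^ k / fact k) - (\<i> * of_real (h n)) ^ r) \<in> O(\<lambda>n. of_real (h n) ^ (r + 1))"
    by simp
  define a where "a k = of_real (M k) * \<i> ^ k / fact k - (if k = r then \<i> ^ r else 0)" for k
  have a_sum: "(\<Sum>k<r + 1. a k * of_real \<omega> ^ k)
      = (\<Sum>k<r + 1. of_real (M k) * (\<i> * of_real \<omega>) ^ k / fact k) - (\<i> * of_real \<omega>) ^ r" for \<omega>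
  proof -
    have "(\<Sum>k<r + 1. a k * of_real \<omega> ^ k) = (\<Sum>k<r + 1. of_real (M k) * (\<i> * of_real \<omega>) ^ k / fact k
        - (if k = r then (\<i> * of_real \<omega>) ^ r else 0))"
      by (intro sum.cong refl) (simp add: a_def left_diff_distrib power_mult_distrib)
    thus ?thesis by (simp only: sum_subtractf) simp
  qed
  have "\<forall>k<r + 1. a k = 0"
  proof (rule asymptotic_expansion_coeffs_zero)
    show "(\<lambda>n. complex_of_real (h n)) \<longlonglongrightarrow> 0"
      using tendsto_of_real[OF h0] by simp
    show "\<forall>\<^sub>F n in sequentially. complex_of_real (h n) \<noteq> 0"
      using hpos by eventually_elim simp
    show "(\<lambda>n. \<Sum>k<r + 1. a k * of_real (h n) ^ k) \<in> O(\<lambda>n. of_real (h n) ^ (r + 1))"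
      unfolding a_sum by (rule diff)
  qed
  hence "(\<Sum>k<r + 1. of_real (M k) * (\<i> * of_real \<omega>) ^ k / fact k) = (\<i> * of_real \<omega>) ^ r" for \<omega>
    using a_sum[of \<omega>] by simp
  with E show ?thesis by simp
qed

text \<open>
  Errors of \<open>m\<close> time steps add up at leading order; products of errors are of order \<open>2 k\<close>.
\<close>

lemma power_expansion:
  assumes u: "(\<lambda>\<omega>. u \<omega> - (1 - a * X \<omega>)) \<in> vanishing n" and X: "X \<in> vanishing k" and k: "n \<le> 2 * k"
  shows "(\<lambda>\<omega>. u \<omega> ^ m - (1 - of_nat m * a * X \<omega>)) \<in> vanishing n"
proof (induction m)
  case (Suc m)
  have X0: "X \<in> vanishing 0"
    by (rule vanishing_mono[OF X]) simp
  have one: "(\<lambda>_. z) \<in> vanishing 0" for z :: complex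
    by simp
  have "(\<lambda>\<omega>. 1 - b * X \<omega>) \<in> vanishing 0" for b
    by (intro sum_in_bigo one) (use X0 in simp)
  note A0 = this
  have "(\<lambda>\<omega>. (u \<omega> - (1 - a * X \<omega>)) + (1 - a * X \<omega>)) \<in> vanishing 0"
    by (rule sum_in_bigo(1)[OF vanishing_mono[OF u] A0]) simp
  hence u0: "u \<in> vanishing 0"
    by simp
  have XX: "(\<lambda>\<omega>. (of_nat m * a * a) * (X \<omega> * X \<omega>)) \<in> vanishing n"
    using vanishing_mono[OF vanishing_mult[OF X X]] k by simp
  have "(\<lambda>\<omega>. (u \<omega> ^ m - (1 - of_nat m * a * X \<omega>)) * u \<omega>
        + (1 - of_nat m * a * X \<omega>) * (u \<omega> - (1 - a * X \<omega>)) + (of_nat m * a * a) * (X \<omega> * X \<omega>)) \<in> vanishing n"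
    using vanishing_mult[OF Suc.IH u0] vanishing_mult[OF A0[of "of_nat m * a"] u]
    by (intro sum_in_bigo(1) XX) simp_all
  thus ?case
    by (simp add: algebra_simps)
qed simp

text \<open>
  Dividing by \<open>1 - g D\<close> shifts the leading error coefficient by \<open>g\<close>, because the geometric series
  begins with \<open>1 + g D\<close>.
\<close>

lemma quotient_expansion:
  assumes v: "(\<lambda>\<omega>. v \<omega> - (1 - a * X \<omega>)) \<in> vanishing n" and D: "(\<lambda>\<omega>. D \<omega> - X \<omega>) \<in> vanishing n"
    and X: "X \<in> vanishing k" and k: "n \<le> 2 * k" "0 < k" "0 < n"
  shows "(\<lambda>\<omega>. v \<omega> / (1 - g * D \<omega>) - (1 - (a - g) * X \<omega>)) \<in> vanishing n"
proof -
  have tendsto_0: "(f \<longlongrightarrow> 0) (at 0)" if f: "f \<in> vanishing l" "0 < l" for f l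
  proof -
    obtain C where C: "\<forall>\<^sub>F \<omega> in at 0. norm (f \<omega>) \<le> C * norm (complex_of_real \<omega> ^ l)"
      using f by (auto elim: landau_o.bigE)
    have "((\<lambda>\<omega>. complex_of_real \<omega> ^ l) \<longlongrightarrow> of_real 0 ^ l) (at 0)"
      by (intro tendsto_intros)
    hence "((\<lambda>\<omega>. complex_of_real \<omega> ^ l) \<longlongrightarrow> 0) (at 0)"
      using f(2) by (simp add: zero_power)
    thus ?thesis
      by (rule tendsto_0_le[where K = C]) (use C in \<open>simp only: mult.commute\<close>)
  qed
  have "((\<lambda>\<omega>. (D \<omega> - X \<omega>) + X \<omega>) \<longlongrightarrow> 0 + 0) (at 0)"
    by (intro tendsto_add tendsto_0[OF D] tendsto_0[OF X] k)
  hence "((\<lambda>\<omega>. 1 - g * D \<omega>) \<longlongrightarrow> 1 - g * 0) (at 0)"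
    by (intro tendsto_intros) simp
  hence lim: "((\<lambda>\<omega>. 1 - g * D \<omega>) \<longlongrightarrow> 1) (at 0)"
    by simp
  hence nz: "\<forall>\<^sub>F \<omega> in at 0. 1 - g * D \<omega> \<noteq> 0"
    by (rule tendsto_imp_eventually_ne) simp
  have "((\<lambda>\<omega>. inverse (1 - g * D \<omega>)) \<longlongrightarrow> inverse 1) (at 0)"
    by (intro tendsto_inverse lim) simp
  hence inv: "(\<lambda>\<omega>. inverse (1 - g * D \<omega>)) \<in> vanishing 0"
    by (rule vanishing_0_of_tendsto)
  have XX: "(\<lambda>\<omega>. X \<omega> * X \<omega>) \<in> vanishing n"
    using vanishing_mono[OF vanishing_mult[OF X X]] k by simp
  have XD: "(\<lambda>\<omega>. X \<omega> * (D \<omega> - X \<omega>)) \<in> vanishing n"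
    using vanishing_mult[OF vanishing_mono[OF X, of 0] D] by simp
  have "(\<lambda>\<omega>. (v \<omega> - (1 - a * X \<omega>)) + g * (D \<omega> - X \<omega>)
       - (a - g) * g * (X \<omega> * (D \<omega> - X \<omega>)) - (a - g) * g * (X \<omega> * X \<omega>)) \<in> vanishing n"
    by (intro sum_in_bigo(2)[OF sum_in_bigo(2)[OF sum_in_bigo(1)[OF v]]] vanishing_cmult D XX XD)
  from vanishing_mult[OF inv this]
  have "(\<lambda>\<omega>. inverse (1 - g * D \<omega>) * ((v \<omega> - (1 - a * X \<omega>)) + g * (D \<omega> - X \<omega>)
       - (a - g) * g * (X \<omega> * (D \<omega> - X \<omega>)) - (a - g) * g * (X \<omega> * X \<omega>))) \<in> vanishing n"
    by simp
  thus ?thesis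
    by (rule landau_o.big.in_cong[THEN iffD1, rotated])
      (use nz in eventually_elim, simp add: field_simps)
qed

lemma fine_eigenvalue_expansion:
  assumes p: "odd p" and c: "cfl \<alpha> h \<delta>t = c"
  shows "(\<lambda>\<omega>. exp (\<i> * of_real (\<omega> * (real m * c))) * fine_eigenvalue p \<alpha> h \<delta>t \<omega> ^ m
      - (1 - of_real (real m * interp_error_poly p (frac c)) * (\<i> * of_real \<omega>) ^ (p + 1))) \<in> vanishing (p + 2)"
proof -
  have E: "exp (\<i> * of_real (\<omega> * (real m * c))) = exp (\<i> * of_real (\<omega> * c)) ^ m" for \<omega>
    by (simp add: mult_ac flip: exp_of_nat_mult)
  show ?thesis
    using power_expansion[OF sl_symbol_expansion[OF p c] ii_omega_power_vanishing, of m]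
    unfolding E power_mult_distrib[symmetric] fine_eigenvalue_def
    by (simp add: power_mult_distrib)
qed

text \<open>
  The correction coefficient is the difference of the leading errors of one coarse step and of \<open>m\<close>
  fine steps, so the corrected coarse step has the same leading error as the \<open>m\<close> fine steps.
\<close>

lemma coarse_eigenvalue_expansion:
  assumes p: "odd p" and c: "cfl \<alpha> h \<delta>t = c" and s: "1 \<le> s" and fd: "finite_difference_rule (p + 1) s d"
  shows "(\<lambda>\<omega>. exp (\<i> * of_real (\<omega> * (real m * c))) * coarse_eigenvalue p m d \<alpha> h \<delta>t \<omega>
      - (1 - of_real (real m * interp_error_poly p (frac c)) * (\<i> * of_real \<omega>) ^ (p + 1))) \<in> vanishing (p + 2)"
proof -
  have c': "cfl \<alpha> h (real m * \<delta>t) = real m * c"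
    using c by (auto simp: cfl_def)
  define g where "g = correction_coeff p m \<alpha> h \<delta>t"
  have D: "(\<lambda>\<omega>. stencil_symbol d \<omega> - (\<i> * of_real \<omega>) ^ (p + 1)) \<in> vanishing (p + 2)"
    using stencil_symbol_expansion[OF fd s] by simp
  have g: "of_real (interp_error_poly p (frac (real m * c))) - of_real g
      = complex_of_real (real m * interp_error_poly p (frac c))"
    unfolding of_real_diff[symmetric] by (simp add: g_def correction_coeff_def c c')
  show ?thesis
    using quotient_expansion[OF sl_symbol_expansion[OF p c'] D ii_omega_power_vanishing, of "of_real g"]
    unfolding g by (simp add: coarse_eigenvalue_def g_def)
qed

section \<open>The coarse-grid correction\<close>

text \<open>
  The modulus equals \<open>2 \<bar>sin (\<phi> / 2)\<bar>\<close>, and \<open>\<bar>\<phi>\<bar> / 2\<close> keeps a distance of at least \<open>a / 2\<close> from the zeros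
  \<open>0\<close> and \<open>\<pi>\<close> of the sine.
\<close>

lemma norm_one_minus_exp_ge:
  fixes \<phi> :: real
  assumes a: "0 < a" "a \<le> pi / 2" and \<phi>: "a \<le> \<bar>\<phi>\<bar>" "\<bar>\<phi>\<bar> \<le> 2 * pi - a"
  shows "2 * sin (a / 2) \<le> cmod (1 - exp (- \<i> * of_real \<phi>))"
proof -
  have "sin (a / 2) \<le> sin (\<bar>\<phi>\<bar> / 2)"
  proof (cases "\<bar>\<phi>\<bar> \<le> pi")
    case True
    thus ?thesis using a \<phi> by (intro sin_mono_le_eq[THEN iffD2]) auto
  next
    case False
    have "sin (a / 2) \<le> sin (pi - \<bar>\<phi>\<bar> / 2)"
      using a \<phi> False by (intro sin_mono_le_eq[THEN iffD2]) auto
    thus ?thesis by simp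
  qed
  moreover have "cmod (1 - exp (- \<i> * of_real \<phi>)) = 2 * \<bar>sin (\<phi> / 2)\<bar>"
  proof -
    have "1 - exp (- \<i> * of_real \<phi>) = 1 - cis (- \<phi>)"
      by (simp add: cis_conv_exp)
    also have "(cmod \<dots>)\<^sup>2 = (1 - cos \<phi>)\<^sup>2 + (sin \<phi>)\<^sup>2"
      by (simp add: cmod_power2)
    also have "\<dots> = 2 - 2 * cos (2 * (\<phi> / 2))"
      using sin_cos_squared_add[of \<phi>] by (simp add: power2_eq_square algebra_simps)
    also have "\<dots> = (2 * \<bar>sin (\<phi> / 2)\<bar>)\<^sup>2"
      unfolding cos_double_sin by (simp add: power_mult_distrib)
    finally show ?thesis
      by (rule power2_eq_imp_eq) auto
  qed
  moreover have "sin (\<bar>\<phi>\<bar> / 2) \<le> \<bar>sin (\<phi> / 2)\<bar>"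
    by (cases "\<phi> \<ge> 0") (auto simp: abs_le_iff)
  ultimately show ?thesis by linarith
qed

text \<open>
  Two lower bounds for the denominator \<open>A\<close> compete. The triangle inequality gives \<open>1 - \<bar>u \<omega>\<bar>\<close>, which
  is of exact order \<open>k\<close> because \<open>\<beta>\<close> is positive and \<open>k\<close> is even; this holds for every \<open>\<theta>\<close> and loses
  \<open>k\<close> of the \<open>k + 1\<close> orders of the numerator. Away from the characteristic \<open>A\<close> is bounded below by a
  constant. The bound on \<open>\<theta>\<close> excludes the other zeros of \<open>1 - exp (- \<i> \<phi>)\<close>, since it keeps
  \<open>\<phi> = M (\<theta> + \<omega> c)\<close> close to \<open>[- \<pi>, \<pi>]\<close>.
\<close>

lemma correction_ratio_bounds:
  fixes u v :: "real \<Rightarrow> complex" and \<beta> c \<delta> M :: real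
  assumes u: "(\<lambda>\<omega>. u \<omega> - (1 - of_real (\<beta> * \<omega> ^ k))) \<in> vanishing (k + 1)"
    and v: "(\<lambda>\<omega>. v \<omega> - (1 - of_real (\<beta> * \<omega> ^ k))) \<in> vanishing (k + 1)"
    and k: "even k" "0 < k" and \<beta>: "0 < \<beta>" and c: "0 < c" and M: "0 < M" and \<delta>: "0 < \<delta>"
  shows "\<exists>C>0. \<exists>\<rho>>0. \<forall>\<omega> \<theta> A. 0 < \<bar>\<omega>\<bar> \<and> \<bar>\<omega>\<bar> \<le> \<rho> \<and> \<bar>M * \<theta>\<bar> \<le> pi \<and>
      A = 1 - u \<omega> * exp (- \<i> * of_real (M * (\<theta> + \<omega> * c))) \<longrightarrow>
      A \<noteq> 0 \<and> (\<delta> \<le> \<bar>\<theta> + \<omega> * c\<bar> \<longrightarrow> cmod (u \<omega> - v \<omega>) / cmod A \<le> C * \<bar>\<omega>\<bar> ^ (k + 1)) \<and>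
      cmod (u \<omega> - v \<omega>) / cmod A \<le> C * \<bar>\<omega>\<bar>"
proof -
  obtain C1 \<rho>1 where 1: "0 < C1" "0 < \<rho>1"
    "\<And>\<omega>. 0 < \<bar>\<omega>\<bar> \<Longrightarrow> \<bar>\<omega>\<bar> < \<rho>1 \<Longrightarrow> cmod (u \<omega> - (1 - of_real (\<beta> * \<omega> ^ k))) \<le> C1 * \<bar>\<omega>\<bar> ^ (k + 1)"
    using vanishingE[OF u] by metis
  obtain C2 \<rho>2 where 2: "0 < C2" "0 < \<rho>2"
    "\<And>\<omega>. 0 < \<bar>\<omega>\<bar> \<Longrightarrow> \<bar>\<omega>\<bar> < \<rho>2 \<Longrightarrow> cmod (v \<omega> - (1 - of_real (\<beta> * \<omega> ^ k))) \<le> C2 * \<bar>\<omega>\<bar> ^ (k + 1)"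
    using vanishingE[OF v] by metis
  define a where "a = min (M * \<delta>) (pi / 2)"
  have a: "0 < a" "a \<le> pi / 2" "a \<le> M * \<delta>"
    using M \<delta> by (auto simp: a_def)
  define \<sigma> where "\<sigma> = sin (a / 2)"
  have \<sigma>: "0 < \<sigma>"
    unfolding \<sigma>_def using a pi_gt_zero by (intro sin_gt_zero) linarith+
  define C where "C = (C1 + C2) * (2 / \<beta> + 1 / \<sigma>)"
  \<comment> \<open>In order: the two expansions hold; powers of \<open>\<bar>\<omega>\<bar>\<close> decrease;
    \<open>1 - \<beta> \<omega>^k\<close> is nonnegative;
    the remainder is at most half of \<open>\<beta> \<omega>^k\<close>;
    \<open>u \<omega>\<close> is within distance \<open>\<sigma>\<close> of \<open>1\<close>;
    the phase moves by at most \<open>\<pi> / 2\<close>.\<close>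
  define S where "S = {\<rho>1 / 2, \<rho>2 / 2, 1, 1 / \<beta>, \<beta> / (2 * C1), \<sigma> / (\<beta> + C1), pi / (2 * (M * c))}"
  define \<rho> where "\<rho> = Min S"
  have C: "C > 0"
    unfolding C_def using 1 2 \<beta> \<sigma> by (intro mult_pos_pos add_pos_pos divide_pos_pos) auto
  have \<rho>: "\<rho> > 0"
  proof -
    have "finite S" "S \<noteq> {}" "\<forall>x\<in>S. 0 < x"
      unfolding S_def using 1(1,2) 2(2) \<beta> \<sigma> M c by simp_all
    thus ?thesis
      unfolding \<rho>_def by (rule Min_gr_iff[THEN iffD2])
  qed
  have \<rho>_le: "\<rho> \<le> x" if "x \<in> S" for x
    unfolding \<rho>_def using that by (intro Min_le) (auto simp: S_def)
  have main: "A \<noteq> 0 \<and> (\<delta> \<le> \<bar>\<theta> + \<omega> * c\<bar> \<longrightarrow> cmod (u \<omega> - v \<omega>) / cmod A \<le> C * \<bar>\<omega>\<bar> ^ (k + 1)) \<and>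
      cmod (u \<omega> - v \<omega>) / cmod A \<le> C * \<bar>\<omega>\<bar>"
    if \<omega>: "0 < \<bar>\<omega>\<bar>" "\<bar>\<omega>\<bar> \<le> \<rho>" and \<theta>: "\<bar>M * \<theta>\<bar> \<le> pi"
      and A: "A = 1 - u \<omega> * exp (- \<i> * of_real (M * (\<theta> + \<omega> * c)))" for \<omega> \<theta> A
  proof -
    define R where "R = \<bar>\<omega>\<bar>"
    have R0: "0 < R" using \<omega> by (simp add: R_def)
    have R: "R \<le> \<rho>1 / 2" "R \<le> \<rho>2 / 2" "R \<le> 1" "R \<le> 1 / \<beta>" "R \<le> \<beta> / (2 * C1)" "R \<le> \<sigma> / (\<beta> + C1)"
      "R \<le> pi / (2 * (M * c))"
      by (rule order_trans[OF \<omega>(2)[folded R_def] \<rho>_le], unfold S_def, (rule insertI1 | rule insertI2)+)+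
    have pow: "\<omega> ^ k = R ^ k"
      using k(1) by (simp add: R_def power_even_abs)
    define e where "e = exp (- \<i> * of_real (M * (\<theta> + \<omega> * c)))"
    have A_eq: "A = 1 - u \<omega> * e"
      unfolding A e_def ..
    have e: "cmod e = 1" by (simp add: e_def)
    have RkR: "R ^ k \<le> R"
      using R0 R(3) k(2) power_decreasing[of 1 k R] by simp
    have Rk1: "C1 * R ^ (k + 1) \<le> \<beta> / 2 * R ^ k"
    proof -
      have "C1 * R \<le> \<beta> / 2"
        using R(5) 1(1) by (simp add: field_simps)
      hence "C1 * R * R ^ k \<le> \<beta> / 2 * R ^ k"
        using R0 by (intro mult_right_mono) auto
      thus ?thesis by (simp add: mult_ac)
    qed
    have U: "cmod (u \<omega> - (1 - of_real (\<beta> * R ^ k))) \<le> C1 * R ^ (k + 1)"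
      using 1(2) 1(3)[of \<omega>] \<omega>(1) R(1) R0 by (simp add: pow flip: R_def)
    have V: "cmod (v \<omega> - (1 - of_real (\<beta> * R ^ k))) \<le> C2 * R ^ (k + 1)"
      using 2(2) 2(3)[of \<omega>] \<omega>(1) R(2) R0 by (simp add: pow flip: R_def)
    have UV: "cmod (u \<omega> - v \<omega>) \<le> (C1 + C2) * R ^ (k + 1)"
      using norm_triangle_ineq4[of "u \<omega> - (1 - of_real (\<beta> * R ^ k))" "v \<omega> - (1 - of_real (\<beta> * R ^ k))"] U V
      by (simp add: distrib_right)
    have "\<beta> * R ^ k \<le> \<beta> * R"
      using RkR \<beta> by (intro mult_left_mono) auto
    also have "\<beta> * R \<le> 1"
      using R(4) \<beta> by (simp add: field_simps)
    finally have b1: "\<beta> * R ^ k \<le> 1" .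
    have "cmod (u \<omega>) \<le> cmod (1 - of_real (\<beta> * R ^ k)) + cmod (u \<omega> - (1 - of_real (\<beta> * R ^ k)))"
      by (rule norm_triangle_sub)
    also have "cmod (1 - of_real (\<beta> * R ^ k)) = cmod (of_real (1 - \<beta> * R ^ k))"
      by simp
    also have "\<dots> = 1 - \<beta> * R ^ k"
      using b1 by (simp only: norm_of_real)
    finally have "cmod (u \<omega>) \<le> 1 - \<beta> / 2 * R ^ k"
      using U Rk1 by linarith
    moreover have "1 - cmod (u \<omega>) \<le> cmod A"
      using norm_triangle_ineq2[of 1 "u \<omega> * e"] e by (simp add: A_eq norm_mult)
    ultimately have A1: "\<beta> / 2 * R ^ k \<le> cmod A"
      by linarith
    have pos: "0 < \<beta> / 2 * R ^ k"
      using \<beta> R0 by simp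
    have "cmod (u \<omega> - v \<omega>) / cmod A \<le> ((C1 + C2) * R ^ (k + 1)) / (\<beta> / 2 * R ^ k)"
      using UV A1 pos 1(1) 2(1) R0 by (intro frac_le) auto
    also have "\<dots> = (C1 + C2) * (2 / \<beta>) * R"
      using \<beta> R0 by (simp add: field_simps)
    also have "\<dots> \<le> C * R"
      unfolding C_def using 1 2 \<beta> \<sigma> R0 by (intro mult_right_mono mult_left_mono) auto
    finally have near: "cmod (u \<omega> - v \<omega>) / cmod A \<le> C * R" .
    have far: "cmod (u \<omega> - v \<omega>) / cmod A \<le> C * R ^ (k + 1)" if D: "\<delta> \<le> \<bar>\<theta> + \<omega> * c\<bar>"
    proof -
      have abs_eq: "\<bar>M * (\<theta> + \<omega> * c)\<bar> = M * \<bar>\<theta> + \<omega> * c\<bar>"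
        using M by (simp add: abs_mult)
      have "M * \<delta> \<le> M * \<bar>\<theta> + \<omega> * c\<bar>"
        using D M by (intro mult_left_mono) auto
      hence lo: "a \<le> \<bar>M * (\<theta> + \<omega> * c)\<bar>"
        using a(3) unfolding abs_eq by linarith
      have "\<bar>M * (\<theta> + \<omega> * c)\<bar> \<le> \<bar>M * \<theta>\<bar> + \<bar>M * (\<omega> * c)\<bar>"
        unfolding distrib_left by (rule abs_triangle_ineq)
      also have "\<bar>M * (\<omega> * c)\<bar> = R * (M * c)"
        using M c by (simp add: abs_mult R_def)
      also have "R * (M * c) \<le> pi / 2"
        using R(7) M c by (simp add: field_simps)
      finally have hi: "\<bar>M * (\<theta> + \<omega> * c)\<bar> \<le> 2 * pi - a"
        using \<theta> a(2) by linarith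
      have "2 * \<sigma> \<le> cmod (1 - e)"
        unfolding \<sigma>_def e_def using a(1,2) lo hi by (rule norm_one_minus_exp_ge)
      also have "1 - e = A + (u \<omega> - 1) * e"
        by (simp add: A_eq algebra_simps)
      also have "cmod \<dots> \<le> cmod A + cmod (u \<omega> - 1)"
        using norm_triangle_ineq[of A "(u \<omega> - 1) * e"] e by (simp add: norm_mult)
      also have "cmod (u \<omega> - 1) \<le> \<sigma>"
      proof -
        have "u \<omega> - 1 = (u \<omega> - (1 - of_real (\<beta> * R ^ k))) - of_real (\<beta> * R ^ k)"
          by simp
        also have "cmod \<dots> \<le> C1 * R ^ (k + 1) + \<beta> * R ^ k"
          using norm_triangle_ineq4[of "u \<omega> - (1 - of_real (\<beta> * R ^ k))" "of_real (\<beta> * R ^ k)"] U \<beta> R0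
          by (simp add: norm_mult norm_power)
        also have "\<dots> \<le> C1 * R + \<beta> * R"
          using RkR R0 R(3) 1(1) \<beta> power_decreasing[of 1 "k + 1" R]
          by (intro add_mono mult_left_mono) auto
        also have "\<dots> \<le> \<sigma>"
          using R(6) 1(1) \<beta> by (simp add: field_simps)
        finally show ?thesis .
      qed
      finally have A2: "\<sigma> \<le> cmod A" by simp
      have "cmod (u \<omega> - v \<omega>) / cmod A \<le> ((C1 + C2) * R ^ (k + 1)) / \<sigma>"
        using UV A2 \<sigma> 1(1) 2(1) R0 by (intro frac_le) auto
      also have "\<dots> = (C1 + C2) * (1 / \<sigma>) * R ^ (k + 1)"
        by simp
      also have "\<dots> \<le> C * R ^ (k + 1)"
        unfolding C_def using 1 2 \<beta> \<sigma> R0 by (intro mult_right_mono mult_left_mono) auto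
      finally show ?thesis .
    qed
    from A1 pos near far show ?thesis
      unfolding R_def by auto
  qed
  show ?thesis
    by (rule exI[of _ C], rule conjI[OF C], rule exI[of _ \<rho>], rule conjI[OF \<rho>])
      (use main in blast)
qed

lemma ii_power_even:
  assumes "even k"
  shows "(\<i> * complex_of_real \<omega>) ^ k = of_real ((- 1) ^ (k div 2) * \<omega> ^ k)"
  using assms by (auto elim!: evenE simp: power_mult_distrib power_mult)

theorem theorem6:
  fixes p m s :: nat and c :: real and d :: "int \<Rightarrow> real"
  assumes p: "odd p" and m: "m \<ge> 2" and s: "s \<ge> 1"
    and c: "c > 0" "c \<notin> \<int>"
    and d: "finite_difference_rule (p + 1) s d"
  shows
    "(\<forall>(\<alpha>::real) (h::real) (\<delta>t::real) (n::nat) (\<omega>::real).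
        \<alpha> > 0 \<and> h > 0 \<and> \<delta>t > 0 \<and> cfl \<alpha> h \<delta>t = c \<and> n > 0 \<and> mesh_frequency n \<omega> \<longrightarrow>
          eigenvector (map_mat complex_of_real (fine_op p \<alpha> h \<delta>t n))
            (fourier_mode h n \<omega>) (fine_eigenvalue p \<alpha> h \<delta>t \<omega>) \<and>
          (invertible_mat (correction_mat p m d \<alpha> h \<delta>t n) \<longrightarrow>
            eigenvector (map_mat complex_of_real (coarse_op p m d \<alpha> h \<delta>t n))
              (fourier_mode h n \<omega>) (coarse_eigenvalue p m d \<alpha> h \<delta>t \<omega>)))
     \<and>
     (\<forall>K>0. \<forall>\<delta>>0. \<exists>C>0. \<exists>h\<^sub>0>0.
        \<forall>(\<alpha>::real) (h::real) (\<delta>t::real) (\<omega>::real) (\<theta>::real).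
          \<alpha> > 0 \<and> 0 < h \<and> h \<le> h\<^sub>0 \<and> \<delta>t > 0 \<and> cfl \<alpha> h \<delta>t = c \<and>
          0 < \<bar>\<omega>\<bar> \<and> \<bar>\<omega>\<bar> \<le> K * h \<and> \<theta> \<in> {- pi / real m ..< pi / real m} \<longrightarrow>
            A1 p m d \<alpha> h \<delta>t \<omega> (real m * \<theta>) \<noteq> 0 \<and>
            (\<bar>\<theta> + \<omega> * \<alpha> * \<delta>t / h\<bar> \<ge> \<delta> \<longrightarrow>
               cgc_ratio p m d \<alpha> h \<delta>t \<omega> (real m * \<theta>) \<le> C * \<bar>\<omega>\<bar> ^ (p + 2)) \<and>
            (\<bar>\<theta> + \<omega> * \<alpha> * \<delta>t / h\<bar> < \<delta> \<longrightarrow>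
               cgc_ratio p m d \<alpha> h \<delta>t \<omega> (real m * \<theta>) \<le> C * \<bar>\<omega>\<bar>))"
proof (intro conjI allI impI)
  fix \<alpha> h \<delta>t \<omega> :: real and n :: nat
  assume "\<alpha> > 0 \<and> h > 0 \<and> \<delta>t > 0 \<and> cfl \<alpha> h \<delta>t = c \<and> n > 0 \<and> mesh_frequency n \<omega>"
  hence hyps: "n > 0" "h > 0" "mesh_frequency n \<omega>" by auto
  show "eigenvector (map_mat complex_of_real (fine_op p \<alpha> h \<delta>t n))
            (fourier_mode h n \<omega>) (fine_eigenvalue p \<alpha> h \<delta>t \<omega>)"
    using sl_mat_mult_fourier_mode[OF hyps] fourier_mode_nonzero[OF hyps(2,1)] fourier_mode_carrier
    by (simp add: eigenvector_def fine_op_def fine_eigenvalue_def sl_mat_def)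
  assume inv: "invertible_mat (correction_mat p m d \<alpha> h \<delta>t n)"
  have fin: "finite {j. d j \<noteq> 0}"
    using d by (simp add: finite_difference_rule_def)
  have "correction_mat p m d \<alpha> h \<delta>t n \<in> carrier_mat n n"
    unfolding correction_mat_def stencil_mat_def
    by (intro minus_carrier_mat smult_carrier_mat mat_carrier)
  from mat_inverse_of_invertible(1)[OF this inv]
  have "dim_row (coarse_op p m d \<alpha> h \<delta>t n) = n"
    by (simp add: coarse_op_def)
  thus "eigenvector (map_mat complex_of_real (coarse_op p m d \<alpha> h \<delta>t n))
              (fourier_mode h n \<omega>) (coarse_eigenvalue p m d \<alpha> h \<delta>t \<omega>)"
    using coarse_op_mult_fourier_mode[OF fin hyps inv] fourier_mode_nonzero[OF hyps(2,1)] fourier_mode_carrier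
    by (simp add: eigenvector_def)
next
  fix K \<delta> :: real
  assume K: "K > 0" and \<delta>: "\<delta> > 0"
  \<comment> \<open>The parameters \<open>1, 1, c\<close> represent all meshes and time steps with CFL number \<open>c\<close>:
    the eigenvalues depend on nothing else.\<close>
  define u where "u \<omega> = exp (\<i> * of_real (\<omega> * (real m * c))) * coarse_eigenvalue p m d 1 1 c \<omega>" for \<omega>
  define v where "v \<omega> = exp (\<i> * of_real (\<omega> * (real m * c))) * fine_eigenvalue p 1 1 c \<omega> ^ m" for \<omega>
  define f where "f = interp_error_poly p (frac c)"
  define \<beta> where "\<beta> = real m * ((- 1) ^ ((p + 1) div 2) * f)"
  have "0 < frac c" "frac c < 1"
    using c by (simp_all add: frac_lt_1)
  from interp_error_poly_sign[OF p this] have \<beta>: "\<beta> > 0"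
    using m by (simp add: \<beta>_def f_def)
  have cfl1: "cfl 1 1 c = c"
    by (simp add: cfl_def)
  have lead: "of_real (real m * f) * (\<i> * complex_of_real \<omega>) ^ (p + 1) = of_real (\<beta> * \<omega> ^ (p + 1))" for \<omega>
    using p by (subst ii_power_even) (simp_all add: \<beta>_def)
  have uv: "(\<lambda>\<omega>. u \<omega> - (1 - of_real (\<beta> * \<omega> ^ (p + 1)))) \<in> vanishing (p + 1 + 1)"
    "(\<lambda>\<omega>. v \<omega> - (1 - of_real (\<beta> * \<omega> ^ (p + 1)))) \<in> vanishing (p + 1 + 1)"
    using coarse_eigenvalue_expansion[OF p cfl1 s d, of m] fine_eigenvalue_expansion[OF p cfl1, of m]
    unfolding u_def v_def lead[symmetric] f_def by simp_all
  have "even (p + 1)" "0 < p + 1" "0 < real m"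
    using p m by simp_all
  from correction_ratio_bounds[OF uv this(1,2) \<beta> c(1) this(3) \<delta>]
  obtain C \<rho> where C: "C > 0" and \<rho>: "\<rho> > 0" and bounds: "\<And>\<omega> \<theta> A. 0 < \<bar>\<omega>\<bar> \<and> \<bar>\<omega>\<bar> \<le> \<rho> \<and> \<bar>real m * \<theta>\<bar> \<le> pi \<and>
      A = 1 - u \<omega> * exp (- \<i> * of_real (real m * (\<theta> + \<omega> * c))) \<longrightarrow>
      A \<noteq> 0 \<and> (\<delta> \<le> \<bar>\<theta> + \<omega> * c\<bar> \<longrightarrow> cmod (u \<omega> - v \<omega>) / cmod A \<le> C * \<bar>\<omega>\<bar> ^ (p + 1 + 1)) \<and>
      cmod (u \<omega> - v \<omega>) / cmod A \<le> C * \<bar>\<omega>\<bar>"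
    by metis
  have main: "A1 p m d \<alpha> h \<delta>t \<omega> (real m * \<theta>) \<noteq> 0 \<and>
      (\<bar>\<theta> + \<omega> * \<alpha> * \<delta>t / h\<bar> \<ge> \<delta> \<longrightarrow> cgc_ratio p m d \<alpha> h \<delta>t \<omega> (real m * \<theta>) \<le> C * \<bar>\<omega>\<bar> ^ (p + 2)) \<and>
      (\<bar>\<theta> + \<omega> * \<alpha> * \<delta>t / h\<bar> < \<delta> \<longrightarrow> cgc_ratio p m d \<alpha> h \<delta>t \<omega> (real m * \<theta>) \<le> C * \<bar>\<omega>\<bar>)"
    if H: "\<alpha> > 0 \<and> 0 < h \<and> h \<le> \<rho> / K \<and> \<delta>t > 0 \<and> cfl \<alpha> h \<delta>t = c \<and>
          0 < \<bar>\<omega>\<bar> \<and> \<bar>\<omega>\<bar> \<le> K * h \<and> \<theta> \<in> {- pi / real m ..< pi / real m}" for \<alpha> h \<delta>t \<omega> \<theta>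
  proof -
    have cfl: "cfl \<alpha> h \<delta>t = c" and cflm: "cfl \<alpha> h (real m * \<delta>t) = real m * c"
      using H by (auto simp: cfl_def)
    have cfl1m: "cfl 1 1 (real m * c) = real m * c"
      by (simp add: cfl_def)
    have shift: "\<omega> * \<alpha> * \<delta>t / h = \<omega> * c"
      using cfl by (auto simp: cfl_def)
    have coarse: "coarse_eigenvalue p m d \<alpha> h \<delta>t \<omega> = coarse_eigenvalue p m d 1 1 c \<omega>"
      by (simp add: coarse_eigenvalue_def sl_symbol_def correction_coeff_def cfl cflm cfl1 cfl1m)
    have fine: "fine_eigenvalue p \<alpha> h \<delta>t \<omega> = fine_eigenvalue p 1 1 c \<omega>"
      by (simp add: fine_eigenvalue_def sl_symbol_def cfl cfl1)
    define e where "e = exp (- \<i> * of_real (real m * (\<theta> + \<omega> * c)))"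
    have "exp (\<i> * of_real (\<omega> * (real m * c))) * e = exp (- \<i> * of_real (real m * \<theta>))"
      unfolding e_def by (simp add: algebra_simps flip: exp_add)
    hence A1: "A1 p m d \<alpha> h \<delta>t \<omega> (real m * \<theta>) = 1 - u \<omega> * e"
      and A1i: "A1_ideal p m \<alpha> h \<delta>t \<omega> (real m * \<theta>) = 1 - v \<omega> * e"
      by (simp_all add: A1_def A1_ideal_def u_def v_def coarse fine mult_ac)
    have "A1 p m d \<alpha> h \<delta>t \<omega> (real m * \<theta>) - A1_ideal p m \<alpha> h \<delta>t \<omega> (real m * \<theta>) = - ((u \<omega> - v \<omega>) * e)"
      unfolding A1 A1i by (simp add: algebra_simps)
    moreover have "cmod e = 1"
      by (simp add: e_def)
    ultimately have ratio: "cgc_ratio p m d \<alpha> h \<delta>t \<omega> (real m * \<theta>)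
        = cmod (u \<omega> - v \<omega>) / cmod (A1 p m d \<alpha> h \<delta>t \<omega> (real m * \<theta>))"
      by (simp add: cgc_ratio_def norm_mult)
    have "K * h \<le> \<rho>"
      using H K by (simp add: field_simps)
    moreover have "\<bar>real m * \<theta>\<bar> \<le> pi"
      using H m by (simp add: abs_le_iff field_simps)
    ultimately show ?thesis
      using bounds[of \<omega> \<theta> "A1 p m d \<alpha> h \<delta>t \<omega> (real m * \<theta>)"] H
      unfolding ratio shift A1 e_def by (simp add: numeral_2_eq_2)
  qed
  show "\<exists>C>0. \<exists>h\<^sub>0>0.
        \<forall>(\<alpha>::real) (h::real) (\<delta>t::real) (\<omega>::real) (\<theta>::real).
          \<alpha> > 0 \<and> 0 < h \<and> h \<le> h\<^sub>0 \<and> \<delta>t > 0 \<and> cfl \<alpha> h \<delta>t = c \<and>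
          0 < \<bar>\<omega>\<bar> \<and> \<bar>\<omega>\<bar> \<le> K * h \<and> \<theta> \<in> {- pi / real m ..< pi / real m} \<longrightarrow>
            A1 p m d \<alpha> h \<delta>t \<omega> (real m * \<theta>) \<noteq> 0 \<and>
            (\<bar>\<theta> + \<omega> * \<alpha> * \<delta>t / h\<bar> \<ge> \<delta> \<longrightarrow>
               cgc_ratio p m d \<alpha> h \<delta>t \<omega> (real m * \<theta>) \<le> C * \<bar>\<omega>\<bar> ^ (p + 2)) \<and>
            (\<bar>\<theta> + \<omega> * \<alpha> * \<delta>t / h\<bar> < \<delta> \<longrightarrow>
               cgc_ratio p m d \<alpha> h \<delta>t \<omega> (real m * \<theta>) \<le> C * \<bar>\<omega>\<bar>)"
    by (rule exI[of _ C], rule conjI[OF C], rule exI[of _ "\<rho> / K"], rule conjI[OF divide_pos_pos[OF \<rho> K]])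
      (intro allI impI, rule main)
qed

end
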